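(* Let $k\ge 2$ be an integer and let $G$ be a graph of order $n\ge \frac{3}{2}k+7$ without isolated vertices. If $\rho(G)\ge \rho(K_2\vee(2K_1\cup K_{n-4}))$, then for every edge $e$ of $G$ there is an $S(k)$-factor of $G$ in which the component containing $e$ is isomorphic to $K_{1,1}$ or $K_{1,2}$, unless $G\cong K_2\vee(2K_1\cup K_{n-4})$.
   Context: All graphs are finite, simple and undirected. A factor of $G$ is a spanning subgraph. $K_{1,m}$ is the star with $m+1$ vertices. For a positive integer $k$, an $S(k)$-factor of $G$ is a factor each of whose components is isomorphic to one of $K_{1,1},K_{1,2},\dots,K_{1,k}$. $\rho(G)$ is the spectral radius of the adjacency matrix of $G$. $K_m$ is the complete graph on $m$ vertices, $mH$ is the disjoint union of $m$ copies of $H$, $\cup$ is disjoint union, and $\vee$ is the join. *)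

theory Defs
  imports
    "Graph_Theory.Pair_Digraph"
    "Graph_Theory.Digraph_Component"
    "Graph_Theory.Digraph_Isomorphism"
    "Graph_Theory.Kuratowski"
    "Jordan_Normal_Form.Spectral_Radius"
begin

text \<open>
  A finite simple undirected graph is a \<^locale>\<open>pair_graph\<close>: a finite set of vertices with a
  finite, symmetric, loop-free set of arcs. An undirected edge \<open>uv\<close> is thus the pair of arcs
  \<open>(u, v)\<close> and \<open>(v, u)\<close>.
\<close>

definition complete_graph :: "nat \<Rightarrow> nat pair_pre_digraph" where
  "complete_graph m = \<lparr> pverts = {..<m}, parcs = {(u, v). u < m \<and> v < m \<and> u \<noteq> v} \<rparr>"

definition disjoint_union ::
  "'a pair_pre_digraph \<Rightarrow> 'b pair_pre_digraph \<Rightarrow> ('a + 'b) pair_pre_digraph" where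
  "disjoint_union G H =
     \<lparr> pverts = Inl ` pverts G \<union> Inr ` pverts H,
       parcs = map_prod Inl Inl ` parcs G \<union> map_prod Inr Inr ` parcs H \<rparr>"

definition graph_copies :: "nat \<Rightarrow> 'a pair_pre_digraph \<Rightarrow> (nat \<times> 'a) pair_pre_digraph" where
  "graph_copies m H =
     \<lparr> pverts = {..<m} \<times> pverts H,
       parcs = {((i, u), (j, v)). i < m \<and> i = j \<and> (u, v) \<in> parcs H} \<rparr>"

definition graph_join ::
  "'a pair_pre_digraph \<Rightarrow> 'b pair_pre_digraph \<Rightarrow> ('a + 'b) pair_pre_digraph" where
  "graph_join G H =
     \<lparr> pverts = pverts (disjoint_union G H),
       parcs = parcs (disjoint_union G H)
         \<union> Inl ` pverts G \<times> Inr ` pverts H \<union> Inr ` pverts H \<times> Inl ` pverts G \<rparr>"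

definition adjacency_matrix :: "'a list \<Rightarrow> 'a pair_pre_digraph \<Rightarrow> complex mat" where
  "adjacency_matrix vs G =
     mat (length vs) (length vs) (\<lambda>(i, j). if (vs ! i, vs ! j) \<in> parcs G then 1 else 0)"

text \<open>
  The matrix depends on an enumeration of the vertices, its spectral radius does not; see
  \<open>graph_spectral_radius_eq\<close> below.
\<close>

definition graph_spectral_radius :: "'a pair_pre_digraph \<Rightarrow> real" where
  "graph_spectral_radius G =
     spectral_radius (adjacency_matrix (SOME vs. distinct vs \<and> set vs = pverts G) G)"

text \<open>
  On a symmetric digraph the strongly connected components (\<open>sccs\<close>) are the connected
  components. \<^const>\<open>complete_bipartite_digraph\<close> \<open>1 m\<close> is the class of graphs isomorphic to the
  star with \<open>m + 1\<close> vertices.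
\<close>

definition is_factor :: "'a pair_pre_digraph \<Rightarrow> 'a pair_pre_digraph \<Rightarrow> bool" where
  "is_factor F G \<longleftrightarrow> pair_graph F \<and> spanning (with_proj F) (with_proj G)"

definition graph_components :: "'a pair_pre_digraph \<Rightarrow> ('a, 'a \<times> 'a) pre_digraph set" where
  "graph_components G = pre_digraph.sccs (with_proj G)"

definition S_factor :: "nat \<Rightarrow> 'a pair_pre_digraph \<Rightarrow> 'a pair_pre_digraph \<Rightarrow> bool" where
  "S_factor k F G \<longleftrightarrow> is_factor F G \<and>
     (\<forall>C \<in> graph_components F. \<exists>m \<in> {1..k}. complete_bipartite_digraph 1 m C)"


lemma complete_digraph_complete_graph: "complete_digraph m (with_proj (complete_graph m))"
  unfolding complete_digraph_pair_def by (auto simp: complete_graph_def)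

lemma pair_graph_complete_graph: "pair_graph (complete_graph m)"
  using complete_digraph_complete_graph by (rule pair_graphI_complete)

lemma pair_graph_graph_copies:
  assumes "pair_graph H" shows "pair_graph (graph_copies m H)"
proof -
  interpret H: pair_graph H by fact
  have "parcs (graph_copies m H) \<subseteq> ({..<m} \<times> pverts H) \<times> ({..<m} \<times> pverts H)"
    by (auto simp: graph_copies_def dest: H.wellformed')
  then have "finite (parcs (graph_copies m H))"
    by (rule finite_subset) (simp add: H.pair_finite_verts)
  then show ?thesis
    by unfold_locales
      (auto simp: graph_copies_def H.pair_finite_verts symmetric_def
        intro!: symI dest: H.wellformed' H.no_loops' H.arcs_symmetric)
qed

lemma pair_graph_disjoint_union:
  assumes "pair_graph G" "pair_graph H" shows "pair_graph (disjoint_union G H)"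
proof -
  interpret G: pair_graph G by fact
  interpret H: pair_graph H by fact
  show ?thesis
    by unfold_locales
      (auto simp: disjoint_union_def G.pair_finite_verts H.pair_finite_verts
        G.pair_finite_arcs H.pair_finite_arcs symmetric_def
        intro!: symI dest: G.wellformed' H.wellformed' G.no_loops' H.no_loops'
          G.arcs_symmetric H.arcs_symmetric)
qed

lemma pair_graph_graph_join:
  assumes "pair_graph G" "pair_graph H" shows "pair_graph (graph_join G H)"
proof -
  interpret G: pair_graph G by fact
  interpret H: pair_graph H by fact
  interpret D: pair_graph "disjoint_union G H" using assms by (rule pair_graph_disjoint_union)
  show ?thesis
  proof unfold_locales
    show "finite (parcs (graph_join G H))"
      by (simp add: graph_join_def G.pair_finite_verts H.pair_finite_verts D.pair_finite_arcs)
    show "symmetric (with_proj (graph_join G H))"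
      using D.pair_sym_arcs by (auto simp: graph_join_def symmetric_def sym_def)
    show "fst e \<noteq> snd e" if "e \<in> parcs (graph_join G H)" for e
      using that D.pair_no_loops[of e] by (auto simp: graph_join_def)
    show "fst e \<in> pverts (graph_join G H)" if "e \<in> parcs (graph_join G H)" for e
      using that D.arc_fst_in_verts[of e] by (auto simp: graph_join_def disjoint_union_def)
    show "snd e \<in> pverts (graph_join G H)" if "e \<in> parcs (graph_join G H)" for e
      using that D.arc_snd_in_verts[of e] by (auto simp: graph_join_def disjoint_union_def)
  qed (simp add: graph_join_def D.pair_finite_verts)
qed

lemma spectrum_adjacency_matrix_subset:
  assumes "distinct vs" "distinct ws" "set vs = set ws"
  shows "spectrum (adjacency_matrix vs G) \<subseteq> spectrum (adjacency_matrix ws G)"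
proof
  define n where "n = length vs"
  have lw: "length ws = n" using assms distinct_card n_def by metis
  have "\<forall>i<n. \<exists>j<n. vs ! j = ws ! i"
    using assms lw n_def by (metis in_set_conv_nth)
  then obtain p where p: "\<And>i. i < n \<Longrightarrow> p i < n \<and> vs ! p i = ws ! i" by metis
  have inj: "inj_on p {..<n}"
    using p assms(2) lw by (metis inj_onI lessThan_iff nth_eq_iff_index_eq)
  then have bij: "bij_betw p {..<n} {..<n}"
    using p by (simp add: bij_betw_def endo_inj_surj image_subset_iff)
  let ?A = "adjacency_matrix vs G" and ?B = "adjacency_matrix ws G"
  fix k assume "k \<in> spectrum ?A"
  then obtain v where v: "v \<in> carrier_vec n" "v \<noteq> 0\<^sub>v n" "?A *\<^sub>v v = k \<cdot>\<^sub>v v"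
    by (auto simp: spectrum_def eigenvalue_def eigenvector_def adjacency_matrix_def n_def)
  define w where "w = vec n (\<lambda>i. v $ p i)"
  have "w \<noteq> 0\<^sub>v n"
  proof
    assume w0: "w = 0\<^sub>v n"
    have "v $ j = 0" if "j < n" for j
    proof -
      have "j \<in> p ` {..<n}" using bij \<open>j < n\<close> by (simp add: bij_betw_def)
      then obtain i where i: "i < n" "p i = j" by auto
      have "w $ i = 0" using w0 i by simp
      then show ?thesis using i by (simp add: w_def)
    qed
    then show False using v by auto
  qed
  moreover have "?B *\<^sub>v w = k \<cdot>\<^sub>v w"
  proof (rule eq_vecI)
    fix i assume "i < dim_vec (k \<cdot>\<^sub>v w)"
    then have i: "i < n" by (simp add: w_def)
    have "(?B *\<^sub>v w) $ i
        = (\<Sum>j<n. (if (ws ! i, ws ! j) \<in> parcs G then 1 else 0) * v $ p j)"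
      using i lw by (simp add: adjacency_matrix_def scalar_prod_def w_def atLeast0LessThan)
    also have "\<dots> = (\<Sum>j<n. (if (vs ! p i, vs ! p j) \<in> parcs G then 1 else 0) * v $ p j)"
      using p i by (intro sum.cong) auto
    also have "\<dots> = (\<Sum>j<n. (if (vs ! p i, vs ! j) \<in> parcs G then 1 else 0) * v $ j)"
      by (rule sum.reindex_bij_betw[OF bij])
    also have "\<dots> = (?A *\<^sub>v v) $ p i"
      using p[OF i] v(1) by (simp add: adjacency_matrix_def scalar_prod_def n_def atLeast0LessThan)
    also have "\<dots> = (k \<cdot>\<^sub>v w) $ i" using p[OF i] i v by (simp add: w_def)
    finally show "(?B *\<^sub>v w) $ i = (k \<cdot>\<^sub>v w) $ i" .
  qed (simp add: adjacency_matrix_def w_def lw)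
  ultimately show "k \<in> spectrum ?B"
    unfolding spectrum_def eigenvalue_def eigenvector_def
    by (auto intro!: exI[of _ w] simp: adjacency_matrix_def lw w_def)
qed

lemma graph_spectral_radius_eq:
  assumes "distinct vs" "set vs = pverts G"
  shows "graph_spectral_radius G = spectral_radius (adjacency_matrix vs G)"
proof -
  define ws where "ws = (SOME ws. distinct ws \<and> set ws = pverts G)"
  have "distinct ws \<and> set ws = pverts G"
    unfolding ws_def by (rule someI[of _ vs]) (use assms in simp)
  then have "spectrum (adjacency_matrix ws G) = spectrum (adjacency_matrix vs G)"
    using assms by (intro equalityI spectrum_adjacency_matrix_subset) auto
  then show ?thesis by (simp add: graph_spectral_radius_def ws_def spectral_radius_def)
qed

end

theory Submission
  imports Defs "HOL-Library.Disjoint_Sets"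
begin

text \<open>
  Since \<open>k \<ge> 2\<close> and \<open>n \<ge> 10\<close>, stars with one or two leaves suffice. Let \<open>uv\<close> be the given edge. If
  two vertices are isolated in \<open>G - u - v\<close>, then \<open>G\<close> is a spanning subgraph of
  \<open>K\<^sub>2 \<or> (2 K\<^sub>1 \<union> K\<^bsub>n-4\<^esub>)\<close>, and strict monotonicity of the spectral radius leaves only this graph
  itself. Otherwise take the star \<open>uv\<close>, enlarged by the isolated vertex of \<open>G - u - v\<close> if there is one,
  and a maximal packing of the remaining graph by stars with one or two leaves. If the packing
  misses a vertex, an exchange argument gives a set \<open>J\<close> of three to five vertices all of whose
  neighbours lie in a set \<open>T\<close>, disjoint from \<open>J\<close>, that consists of \<open>u\<close>, \<open>v\<close> and the centers of the
  packed stars with two leaves. An explicit positive weight on the vertices then shows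
  \<open>\<rho>(G) \<le> n - 3\<close>, while \<open>\<rho>(K\<^sub>2 \<or> (2 K\<^sub>1 \<union> K\<^bsub>n-4\<^esub>)) > n - 3\<close>.
\<close>

section \<open>Spectral radius and weights on the vertices\<close>

lemma sum_neighbours_eq:
  assumes "distinct vs" "set vs = pverts G" "pair_graph G" "v \<in> pverts G"
  shows "(\<Sum>j<length vs. (if (v, vs ! j) \<in> parcs G then f (vs ! j) else 0))
    = (\<Sum>w | (v, w) \<in> parcs G. f w :: 'b :: comm_monoid_add)"
proof -
  interpret pair_graph G by fact
  have "(\<Sum>j<length vs. (if (v, vs ! j) \<in> parcs G then f (vs ! j) else 0))
      = (\<Sum>w\<in>pverts G. if (v, w) \<in> parcs G then f w else 0)"
    using assms
    by (intro sum.reindex_bij_betw[where h = "(!) vs"] bij_betw_nth) auto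
  also have "\<dots> = (\<Sum>w | (v, w) \<in> parcs G. f w)"
    by (subst sum.inter_filter[symmetric])
      (auto simp: pair_finite_verts intro!: sum.cong dest: wellformed')
  finally show ?thesis .
qed

lemma index_adjacency_matrix_mult_vec:
  assumes "distinct vs" "set vs = pverts G" "pair_graph G" "i < length vs"
  shows "(adjacency_matrix vs G *\<^sub>v vec (length vs) (\<lambda>i. f (vs ! i))) $ i
    = (\<Sum>w | (vs ! i, w) \<in> parcs G. f w)"
proof -
  have "(adjacency_matrix vs G *\<^sub>v vec (length vs) (\<lambda>i. f (vs ! i))) $ i
      = (\<Sum>j<length vs. (if (vs ! i, vs ! j) \<in> parcs G then f (vs ! j) else 0))"
    using assms(4)
    by (auto simp: adjacency_matrix_def scalar_prod_def atLeast0LessThan intro!: sum.cong)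
  also have "\<dots> = (\<Sum>w | (vs ! i, w) \<in> parcs G. f w)"
    using assms nth_mem by (intro sum_neighbours_eq) blast+
  finally show ?thesis .
qed

lemma adjacency_matrix_carrier: "adjacency_matrix vs G \<in> carrier_mat (length vs) (length vs)"
  by (simp add: adjacency_matrix_def)

text \<open>Read in the order of an enumeration, \<open>f\<close> becomes a nonzero complex
  eigenvector, and the spectral radius is the largest modulus in the spectrum.\<close>

lemma eigenvalue_le_graph_spectral_radius:
  fixes f :: "'a \<Rightarrow> real"
  assumes "pair_graph G" "u \<in> pverts G" "f u \<noteq> 0"
    and eig: "\<And>v. v \<in> pverts G \<Longrightarrow> (\<Sum>w | (v, w) \<in> parcs G. f w) = r * f v"
  shows "r \<le> graph_spectral_radius G"
proof -
  interpret pair_graph G by fact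
  obtain vs where vs: "distinct vs" "set vs = pverts G"
    using finite_distinct_list[OF pair_finite_verts] by blast
  let ?n = "length vs" and ?A = "adjacency_matrix vs G"
  let ?x = "vec ?n (\<lambda>i. complex_of_real (f (vs ! i)))"
  obtain i where i: "i < ?n" "vs ! i = u" using assms vs by (metis in_set_conv_nth)
  have "?A *\<^sub>v ?x = complex_of_real r \<cdot>\<^sub>v ?x"
  proof (rule eq_vecI)
    fix j assume "j < dim_vec (complex_of_real r \<cdot>\<^sub>v ?x)"
    then have j: "j < ?n" by simp
    have "(?A *\<^sub>v ?x) $ j = (\<Sum>w | (vs ! j, w) \<in> parcs G. complex_of_real (f w))"
      by (rule index_adjacency_matrix_mult_vec) (use vs j assms in auto)
    also have "\<dots> = complex_of_real (r * f (vs ! j))"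
      using eig[of "vs ! j"] j vs by (metis of_real_sum nth_mem)
    finally show "(?A *\<^sub>v ?x) $ j = (complex_of_real r \<cdot>\<^sub>v ?x) $ j" using j by simp
  qed (simp add: adjacency_matrix_def)
  moreover have "?x \<noteq> 0\<^sub>v ?n"
  proof
    assume "?x = 0\<^sub>v ?n"
    then have "?x $ i = 0\<^sub>v ?n $ i" by simp
    then show False using i assms(3) by simp
  qed
  ultimately have "complex_of_real r \<in> spectrum ?A"
    unfolding spectrum_def eigenvalue_def eigenvector_def
    by (auto intro!: exI[of _ ?x] simp: adjacency_matrix_def)
  then have "norm (complex_of_real r) \<in> norm ` spectrum ?A" by (rule imageI)
  then have "norm (complex_of_real r) \<le> spectral_radius ?A"
    using spectral_radius_mem_max(2)[OF adjacency_matrix_carrier] i by (metis gr_implies_not0 not_gr0)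
  then show ?thesis using graph_spectral_radius_eq[OF vs] by simp
qed

text \<open>The moduli of the entries of an eigenvector for an eigenvalue of largest modulus.\<close>

lemma graph_spectral_radius_subeigenvector:
  assumes "pair_graph G" "pverts G \<noteq> {}"
  obtains g :: "'a \<Rightarrow> real" where "\<And>v. g v \<ge> 0" "\<exists>v \<in> pverts G. g v \<noteq> 0"
    "\<And>v. v \<in> pverts G \<Longrightarrow> graph_spectral_radius G * g v \<le> (\<Sum>w | (v, w) \<in> parcs G. g w)"
proof -
  interpret pair_graph G by fact
  obtain vs where vs: "distinct vs" "set vs = pverts G"
    using finite_distinct_list[OF pair_finite_verts] by blast
  let ?n = "length vs" and ?A = "adjacency_matrix vs G"
  have "?n > 0" using vs assms(2) by auto
  from spectral_radius_mem_max(1)[OF adjacency_matrix_carrier this, of G]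
  obtain l where l: "eigenvalue ?A l" "graph_spectral_radius G = norm l"
    by (auto simp: graph_spectral_radius_eq[OF vs] spectrum_def)
  then obtain x where x: "x \<in> carrier_vec ?n" "x \<noteq> 0\<^sub>v ?n" "?A *\<^sub>v x = l \<cdot>\<^sub>v x"
    by (auto simp: eigenvalue_def eigenvector_def adjacency_matrix_def)
  \<comment> \<open>The eigenvector is moved from positions to vertices by inverting the enumeration
    \<open>vs\<close>.\<close>
  have "\<exists>h. \<forall>i<?n. h (vs ! i) = x $ i"
    using vs(1)
    by (intro exI[of _ "\<lambda>v. x $ the_inv_into {..<?n} ((!) vs) v"])
      (simp add: the_inv_into_f_f inj_on_nth)
  then obtain h where h: "\<And>i. i < ?n \<Longrightarrow> h (vs ! i) = x $ i" by blast
  have xh: "x = vec ?n (\<lambda>i. h (vs ! i))" using x h by auto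
  show thesis
  proof (rule that[of "\<lambda>v. norm (h v)"])
    show "\<exists>v\<in>pverts G. norm (h v) \<noteq> 0"
    proof (rule ccontr)
      assume "\<not> ?thesis"
      then have "h (vs ! i) = 0" if "i < ?n" for i using that vs by auto
      then have "x = 0\<^sub>v ?n" unfolding xh by auto
      then show False using x by simp
    qed
    fix v assume "v \<in> pverts G"
    then obtain i where i: "i < ?n" "vs ! i = v" using vs by (metis in_set_conv_nth)
    have "l * h v = (?A *\<^sub>v x) $ i" using x i h[OF i(1)] by simp
    also have "\<dots> = (\<Sum>w | (v, w) \<in> parcs G. h w)"
      unfolding xh using index_adjacency_matrix_mult_vec[OF vs assms(1) i(1)] i by simp
    finally show "graph_spectral_radius G * norm (h v) \<le> (\<Sum>w | (v, w) \<in> parcs G. norm (h w))"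
      unfolding l(2) by (metis norm_mult norm_sum)
  qed simp
qed

text \<open>Symmetry of the adjacency matrix, seen as a bilinear form: a test weight can be moved
  across it.\<close>

lemma sum_neighbours_swap:
  fixes f g :: "'a \<Rightarrow> real"
  assumes "pair_graph G"
  shows "(\<Sum>v\<in>pverts G. f v * (\<Sum>w | (v, w) \<in> parcs G. g w))
    = (\<Sum>v\<in>pverts G. g v * (\<Sum>w | (v, w) \<in> parcs G. f w))"
proof -
  interpret pair_graph G by fact
  have nb: "(\<Sum>w | (v, w) \<in> parcs G. h w) = (\<Sum>w\<in>pverts G. if (v, w) \<in> parcs G then h w else 0)"
    for v and h :: "'a \<Rightarrow> real"
    by (subst sum.inter_filter[symmetric])
      (auto simp: pair_finite_verts intro!: sum.cong dest: wellformed')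
  have sym: "(v, w) \<in> parcs G \<longleftrightarrow> (w, v) \<in> parcs G" for v w using arcs_symmetric by blast
  have "(\<Sum>v\<in>pverts G. f v * (\<Sum>w | (v, w) \<in> parcs G. g w))
      = (\<Sum>v\<in>pverts G. \<Sum>w\<in>pverts G. if (v, w) \<in> parcs G then f v * g w else 0)"
    unfolding nb sum_distrib_left by (intro sum.cong) auto
  also have "\<dots> = (\<Sum>w\<in>pverts G. \<Sum>v\<in>pverts G. if (v, w) \<in> parcs G then f v * g w else 0)"
    by (rule sum.swap)
  also have "\<dots> = (\<Sum>v\<in>pverts G. g v * (\<Sum>w | (v, w) \<in> parcs G. f w))"
    unfolding nb sum_distrib_left by (intro sum.cong) (auto dest: sym[THEN iffD1])
  finally show ?thesis .
qed

text \<open>Collatz-Wielandt bound. Pairing the positive \<open>y\<close> with a nonnegative nonzero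
  subeigenvector \<open>g\<close> compares both constants on the same positive number
  \<open>?s\<close>.\<close>

lemma graph_spectral_radius_le:
  fixes y :: "'a \<Rightarrow> real"
  assumes "pair_graph G" "pverts G \<noteq> {}" "\<And>v. v \<in> pverts G \<Longrightarrow> y v > 0"
    and le: "\<And>v. v \<in> pverts G \<Longrightarrow> (\<Sum>w | (v, w) \<in> parcs G. y w) \<le> c * y v"
  shows "graph_spectral_radius G \<le> c"
proof -
  interpret pair_graph G by fact
  obtain g where g: "\<And>v. g v \<ge> 0" "\<exists>v \<in> pverts G. g v \<noteq> 0"
    "\<And>v. v \<in> pverts G \<Longrightarrow> graph_spectral_radius G * g v \<le> (\<Sum>w | (v, w) \<in> parcs G. g w)"
    using graph_spectral_radius_subeigenvector[OF assms(1,2)] by blast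
  let ?s = "\<Sum>v\<in>pverts G. y v * g v"
  have "?s > 0"
  proof -
    obtain v where "v \<in> pverts G" "g v \<noteq> 0" using g(2) by blast
    then have "v \<in> pverts G" "y v * g v > 0" using g(1)[of v] assms(3) by auto
    then show ?thesis
      using assms(3) g(1) by (intro sum_pos2[OF pair_finite_verts]) (auto simp: less_imp_le)
  qed
  have "graph_spectral_radius G * ?s = (\<Sum>v\<in>pverts G. y v * (graph_spectral_radius G * g v))"
    by (simp add: sum_distrib_left mult_ac)
  also have "\<dots> \<le> (\<Sum>v\<in>pverts G. y v * (\<Sum>w | (v, w) \<in> parcs G. g w))"
    using g(3) assms(3) by (intro sum_mono mult_left_mono) (auto simp: less_imp_le)
  also have "\<dots> = (\<Sum>v\<in>pverts G. g v * (\<Sum>w | (v, w) \<in> parcs G. y w))"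
    by (rule sum_neighbours_swap) fact
  also have "\<dots> \<le> (\<Sum>v\<in>pverts G. g v * (c * y v))"
    using le g(1) by (intro sum_mono mult_left_mono) auto
  also have "\<dots> = c * ?s" by (simp add: sum_distrib_left mult_ac)
  finally show ?thesis using \<open>?s > 0\<close> by simp
qed

text \<open>
  Equality would force a nonnegative eigenvector for the eigenvalue \<open>r\<close> of the larger graph that
  vanishes at an end of a missing arc, hence at the universal vertex, hence everywhere.
\<close>

lemma graph_spectral_radius_less:
  fixes y :: "'a \<Rightarrow> real"
  assumes G: "pair_graph G" and H: "pair_graph H"
    and sub: "pverts G = pverts H" "parcs G \<subset> parcs H"
    and univ: "a \<in> pverts H" "\<And>v. v \<in> pverts H \<Longrightarrow> v \<noteq> a \<Longrightarrow> (a, v) \<in> parcs H"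
    and pos: "\<And>v. v \<in> pverts H \<Longrightarrow> y v > 0"
    and eig: "\<And>v. v \<in> pverts H \<Longrightarrow> (\<Sum>w | (v, w) \<in> parcs H. y w) = r * y v"
  shows "graph_spectral_radius G < r"
proof (rule ccontr)
  assume "\<not> graph_spectral_radius G < r"
  then have ge: "r \<le> graph_spectral_radius G" by simp
  interpret G: pair_graph G by fact
  interpret H: pair_graph H by fact
  let ?V = "pverts H"
  have ne: "pverts G \<noteq> {}" using univ sub by auto
  obtain g where g: "\<And>v. g v \<ge> 0" "\<exists>v \<in> pverts G. g v \<noteq> 0"
    "\<And>v. v \<in> pverts G \<Longrightarrow> graph_spectral_radius G * g v \<le> (\<Sum>w | (v, w) \<in> parcs G. g w)"
    using graph_spectral_radius_subeigenvector[OF G ne] by blast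
  let ?G = "\<lambda>v. \<Sum>w | (v, w) \<in> parcs G. g w" and ?H = "\<lambda>v. \<Sum>w | (v, w) \<in> parcs H. g w"
  have fin: "finite {w. (v, w) \<in> parcs H}" for v
    by (rule finite_subset[OF _ H.pair_finite_verts]) (auto dest: H.wellformed')
  have 1: "r * g v \<le> ?G v" if "v \<in> ?V" for v
    using g(3)[of v] mult_right_mono[OF ge g(1)[of v]] that sub by auto
  have 2: "?G v \<le> ?H v" for v
    using sub(2) by (intro sum_mono2[OF fin]) (auto simp: g(1))
  \<comment> \<open>By 1 and 2, \<open>?H v - r * g v\<close> is nonnegative. Its pairing with the
    positive eigenvector \<open>y\<close> is zero, so it vanishes at each vertex, and 1 and 2 become
    equalities.\<close>
  have "(\<Sum>v\<in>?V. y v * ?H v) = (\<Sum>v\<in>?V. g v * (\<Sum>w | (v, w) \<in> parcs H. y w))"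
    by (rule sum_neighbours_swap) fact
  also have "\<dots> = (\<Sum>v\<in>?V. y v * (r * g v))"
    using eig by (intro sum.cong) auto
  finally have "(\<Sum>v\<in>?V. y v * (?H v - r * g v)) = 0"
    by (simp add: right_diff_distrib sum_subtractf)
  then have "\<forall>v\<in>?V. y v * (?H v - r * g v) = 0"
  proof (subst (asm) sum_nonneg_eq_0_iff)
    fix v assume "v \<in> ?V"
    then show "0 \<le> y v * (?H v - r * g v)"
      using 1[of v] 2[of v] pos[of v] by (intro mult_nonneg_nonneg) auto
  qed (auto simp: H.pair_finite_verts)
  then have eq: "?H v = r * g v" if "v \<in> ?V" for v using that pos[of v] by auto
  then have eqG: "?G v = ?H v" if "v \<in> ?V" for v using 1[of v] 2[of v] that by force
  \<comment> \<open>At a zero of \<open>g\<close> the neighbour sum is zero, and its terms are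
    nonnegative.\<close>
  have zero: "g w = 0" if "v \<in> ?V" "g v = 0" "(v, w) \<in> parcs H" for v w
  proof -
    have "?H v = 0" using eq that by simp
    then show ?thesis using that by (subst (asm) sum_nonneg_eq_0_iff) (auto simp: fin g(1))
  qed
  obtain p q where pq: "(p, q) \<in> parcs H" "(p, q) \<notin> parcs G" using sub(2) by auto
  then have pqV: "p \<in> ?V" "q \<in> ?V" by (auto dest: H.wellformed')
  have "g q = 0"
  proof -
    \<comment> \<open>The neighbour sum of \<open>p\<close> in \<open>H\<close> contains the
      additional term \<open>g q\<close>, although both sums are equal.\<close>
    have "?G p + g q = (\<Sum>w \<in> insert q {w. (p, w) \<in> parcs G}. g w)"
    proof (subst sum.insert)
      show "finite {w. (p, w) \<in> parcs G}"
        using sub(2) by (intro finite_subset[OF _ fin[of p]]) auto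
    qed (use pq in auto)
    also have "\<dots> \<le> ?H p" using sub(2) pq by (intro sum_mono2[OF fin]) (auto simp: g(1))
    finally show ?thesis using eqG[OF pqV(1)] g(1)[of q] by simp
  qed
  then have "g a = 0"
    using zero[OF pqV(2)] univ pqV H.arcs_symmetric by (cases "q = a") auto
  then have "g v = 0" if "v \<in> ?V" for v
    using zero[OF univ(1)] univ(2)[OF that] by (cases "v = a") auto
  then show False using g(2) sub(1) by auto
qed

section \<open>Graphs \<open>K\<^sub>t \<or> (j K\<^sub>1 \<union> K\<^sub>m)\<close>\<close>

text \<open>For disjoint \<open>T\<close> and \<open>J\<close> in \<open>V\<close> these are the
  arcs of the graph in the section title. Keeping the vertex set of the given graph reduces
  comparison with it to inclusion of arcs.\<close>

definition split_arcs :: "'a set \<Rightarrow> 'a set \<Rightarrow> 'a set \<Rightarrow> ('a \<times> 'a) set" where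
  "split_arcs V T J =
     {(v, w). v \<in> V \<and> w \<in> V \<and> v \<noteq> w \<and> (v \<in> T \<or> w \<in> T \<or> v \<notin> J \<and> w \<notin> J)}"

lemma pair_graph_split_arcs:
  assumes "finite V"
  shows "pair_graph \<lparr> pverts = V, parcs = split_arcs V T J \<rparr>"
proof -
  have "finite (split_arcs V T J)"
    by (rule finite_subset[of _ "V \<times> V"]) (use assms in \<open>auto simp: split_arcs_def\<close>)
  then show ?thesis
    using assms by unfold_locales (auto simp: split_arcs_def symmetric_def sym_def)
qed

text \<open>A weight that is constant on the three classes, that is, a vector for the quotient
  matrix.\<close>

definition split_weight :: "'a set \<Rightarrow> 'a set \<Rightarrow> real \<Rightarrow> real \<Rightarrow> real \<Rightarrow> 'a \<Rightarrow> real" where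
  "split_weight T J \<beta> \<alpha> \<gamma> v = (if v \<in> T then \<beta> else if v \<in> J then \<alpha> else \<gamma>)"

text \<open>The partition into \<open>T\<close>, \<open>J\<close> and the rest is equitable; the
  three cases are the rows of its quotient matrix.\<close>

lemma sum_split_arcs:
  fixes \<beta> \<alpha> \<gamma> :: real
  assumes "finite V" "T \<subseteq> V" "J \<subseteq> V" "T \<inter> J = {}" "v \<in> V"
  shows "(\<Sum>w | (v, w) \<in> split_arcs V T J. split_weight T J \<beta> \<alpha> \<gamma> w) =
    (if v \<in> T then (real (card T) - 1) * \<beta> + card J * \<alpha> + real (card (V - T - J)) * \<gamma>
     else if v \<in> J then card T * \<beta>
     else card T * \<beta> + (real (card (V - T - J)) - 1) * \<gamma>)"
proof -
  let ?R = "V - T - J" and ?y = "split_weight T J \<beta> \<alpha> \<gamma>"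
  have fin: "finite T" "finite J" "finite ?R" using assms finite_subset by auto
  have sT: "sum ?y A = card A * \<beta>" if "A \<subseteq> T" for A
    using that by (subst sum.cong[of A A ?y "\<lambda>_. \<beta>"]) (auto simp: split_weight_def)
  have sJ: "sum ?y J = card J * \<alpha>"
    using assms(4) by (subst sum.cong[of J J ?y "\<lambda>_. \<alpha>"]) (auto simp: split_weight_def)
  have sR: "sum ?y A = card A * \<gamma>" if "A \<subseteq> ?R" for A
    using that by (subst sum.cong[of A A ?y "\<lambda>_. \<gamma>"]) (auto simp: split_weight_def)
  consider "v \<in> T" | "v \<in> J" "v \<notin> T" | "v \<in> ?R" using assms(5) by blast
  then show ?thesis
  proof cases
    case 1
    have "{w. (v, w) \<in> split_arcs V T J} = (T - {v}) \<union> J \<union> ?R"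
      using 1 assms by (auto simp: split_arcs_def)
    moreover have "sum ?y ((T - {v}) \<union> J \<union> ?R) = sum ?y (T - {v}) + sum ?y J + sum ?y ?R"
      using assms(4) fin by (subst sum.union_disjoint; (subst sum.union_disjoint)?) auto
    moreover have "real (card (T - {v})) = real (card T) - 1"
      using 1 fin(1) by (metis card_Diff_singleton card_gt_0_iff empty_iff of_nat_1 of_nat_diff Suc_leI One_nat_def)
    ultimately show ?thesis using 1 sT[of "T - {v}"] sJ sR[of ?R] by auto
  next
    case 2
    have "{w. (v, w) \<in> split_arcs V T J} = T"
      using 2 assms by (auto simp: split_arcs_def)
    then show ?thesis using 2 sT[of T] by auto
  next
    case 3
    have "{w. (v, w) \<in> split_arcs V T J} = T \<union> (?R - {v})"
      using 3 assms by (auto simp: split_arcs_def)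
    moreover have "sum ?y (T \<union> (?R - {v})) = sum ?y T + sum ?y (?R - {v})"
      using fin by (subst sum.union_disjoint) auto
    moreover have "real (card (?R - {v})) = real (card ?R) - 1"
      using 3 fin(3) by (metis card_Diff_singleton card_gt_0_iff empty_iff of_nat_1 of_nat_diff Suc_leI One_nat_def)
    ultimately show ?thesis using 3 sT[of T] sR[of "?R - {v}"] by auto
  qed
qed

lemma card_split_rest:
  assumes "finite V" "T \<subseteq> V" "J \<subseteq> V" "T \<inter> J = {}"
  shows "real (card (V - T - J)) = real (card V) - real (card T) - real (card J)"
proof -
  have "finite T" "finite J" using assms finite_subset by blast+
  then have "card T + card J = card (T \<union> J)" using assms(4) by (simp add: card_Un_disjoint)
  moreover have "card (T \<union> J) + card (V - (T \<union> J)) = card V"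
    using assms by (metis card_Diff_subset card_mono finite_subset le_add_diff_inverse le_sup_iff)
  ultimately show ?thesis by (simp add: Diff_eq Int_assoc)
qed

text \<open>Dropping arcs only lowers the neighbour sums of a positive weight, so a test weight for
  the full split graph also bounds \<open>G\<close>.\<close>

lemma graph_spectral_radius_split_le:
  assumes "pair_graph G" and sub: "parcs G \<subseteq> split_arcs (pverts G) T J"
    and TJ: "T \<subseteq> pverts G" "J \<subseteq> pverts G" "T \<inter> J = {}"
    and t: "card T = t" "t \<ge> 1" and j: "card J = j" "j \<ge> 3" and n: "card (pverts G) = n"
    and bound: "real j * real t * (real t + real j - 2) \<le> (real j - 2) * ((real n - 2) * (real n - 3))"
  shows "graph_spectral_radius G \<le> real n - 3"
proof -
  interpret pair_graph G by fact
  let ?V = "pverts G"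
  \<comment> \<open>These weights turn the rows of \<open>J\<close> and of \<open>V - T - J\<close> into equalities for the value
    \<open>n - 3\<close>; the rows of \<open>T\<close> then amount to the assumption \<open>bound\<close>.\<close>
  define \<beta> \<alpha> \<gamma> where "\<beta> = (real n - 3) * (real t + j - 2)"
    and "\<alpha> = real t * (real t + j - 2)" and "\<gamma> = real t * (real n - 3)"
  let ?y = "split_weight T J \<beta> \<alpha> \<gamma>"
  have fin: "finite ?V" by (rule pair_finite_verts)
  have rest: "real (card (?V - T - J)) = real n - t - j"
    using card_split_rest[OF fin TJ] t j n by simp
  then have "real t + j \<le> n" by (metis diff_diff_eq diff_ge_0_iff_ge of_nat_0_le_iff)
  then have n4: "real n \<ge> 4" using t j by linarith
  have pos: "\<alpha> > 0" "\<beta> > 0" "\<gamma> > 0"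
    unfolding \<alpha>_def \<beta>_def \<gamma>_def using n4 t j by (auto intro!: mult_pos_pos)
  then have ypos: "?y v > 0" for v by (simp add: split_weight_def)
  have fin': "finite {w. (v, w) \<in> split_arcs ?V T J}" for v
    by (rule finite_subset[OF _ fin]) (auto simp: split_arcs_def)
  have bound': "real j * \<alpha> \<le> (real j - 2) * (real n - 2) * (real n - 3)"
    using bound by (simp add: \<alpha>_def mult_ac)
  have T_row: "(real t - 1) * \<beta> + j * \<alpha> + (real n - t - j) * \<gamma> \<le> (real n - 3) * \<beta>"
  proof -
    \<comment> \<open>Here \<open>t\<close> cancels; it survives only in the term
      \<open>j * \<alpha>\<close>, which \<open>bound'\<close> controls.\<close>
    have "(real n - 3) * \<beta> - (real t - 1) * \<beta> - (real n - t - j) * \<gamma>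
        = (real j - 2) * (real n - 2) * (real n - 3)"
      by (simp add: \<beta>_def \<gamma>_def algebra_simps)
    then show ?thesis using bound' by linarith
  qed
  have J_row: "t * \<beta> = (real n - 3) * \<alpha>" by (simp add: \<beta>_def \<alpha>_def)
  have R_row: "t * \<beta> + (real n - t - j - 1) * \<gamma> = (real n - 3) * \<gamma>"
    by (simp add: \<beta>_def \<gamma>_def algebra_simps)
  show ?thesis
  proof (rule graph_spectral_radius_le[where y = ?y])
    show "?V \<noteq> {}" using n n4 by auto
    fix v assume v: "v \<in> ?V"
    have "(\<Sum>w | (v, w) \<in> parcs G. ?y w) \<le> (\<Sum>w | (v, w) \<in> split_arcs ?V T J. ?y w)"
      using sub by (intro sum_mono2[OF fin']) (auto simp: ypos less_imp_le)
    also have "\<dots> \<le> (real n - 3) * ?y v"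
      unfolding sum_split_arcs[OF fin TJ v] rest t(1) j(1)
      using T_row J_row R_row by (simp add: split_weight_def)
    finally show "(\<Sum>w | (v, w) \<in> parcs G. ?y w) \<le> (real n - 3) * ?y v" .
  qed (use assms ypos in auto)
qed

text \<open>
  The quotient of \<open>K\<^sub>2 \<or> (2 K\<^sub>1 \<union> K\<^bsub>n-4\<^esub>)\<close> by its three vertex classes has the eigenvector
  below exactly for the roots of this cubic.
\<close>

definition extremal_root :: "nat \<Rightarrow> real \<Rightarrow> bool" where
  "extremal_root n r \<longleftrightarrow> r > real n - 3 \<and>
     r * (r - 1) * (r - n + 5) = 4 * (r - n + 5) + 2 * (real n - 4) * r"

definition extremal_weight :: "nat \<Rightarrow> real \<Rightarrow> 'a set \<Rightarrow> 'a set \<Rightarrow> 'a \<Rightarrow> real" where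
  "extremal_weight n r T J =
     split_weight T J (r * (r - n + 5)) (2 * (r - n + 5)) (2 * r)"

text \<open>The cubic has the value -8 at \<open>n - 3\<close> and a nonnegative one at
  \<open>n - 2\<close>, so the intermediate value theorem gives a root strictly above
  \<open>n - 3\<close>.\<close>

lemma ex_extremal_root:
  assumes "n \<ge> 5"
  shows "\<exists>r. extremal_root n r"
proof -
  define f where "f r = r * (r - 1) * (r - n + 5) - 4 * (r - n + 5) - 2 * (real n - 4) * r"
    for r :: real
  define m where "m = real n - 5"
  have m: "real n = m + 5" "m \<ge> 0" using assms by (auto simp: m_def)
  have lo: "f (real n - 3) < 0" by (simp add: f_def algebra_simps)
  have "f (real n - 2) = m * m + 7 * m"
    by (simp add: f_def m algebra_simps)
  then have hi: "f (real n - 2) \<ge> 0" using m by simp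
  obtain r where r: "real n - 3 \<le> r" "r \<le> real n - 2" "f r = 0"
  proof -
    have "continuous_on {real n - 3..real n - 2} f"
      unfolding f_def by (intro continuous_intros)
    then show ?thesis
      using IVT'[of f "real n - 3" 0 "real n - 2"] lo hi that by auto
  qed
  moreover have "r \<noteq> real n - 3" using r lo by auto
  ultimately show ?thesis unfolding extremal_root_def f_def by (intro exI[of _ r]) auto
qed

lemma extremal_weight_pos:
  assumes "extremal_root n r" "n \<ge> 5"
  shows "extremal_weight n r T J v > 0"
proof -
  have "r > 0" "r - n + 5 > 0" using assms by (auto simp: extremal_root_def)
  then show ?thesis by (auto simp: extremal_weight_def split_weight_def)
qed

lemma extremal_weight_eigenvector:
  assumes "extremal_root n r" "n \<ge> 5" "finite V" "card V = n"
    "T \<subseteq> V" "J \<subseteq> V" "T \<inter> J = {}" "card T = 2" "card J = 2" "v \<in> V"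
  shows "(\<Sum>w | (v, w) \<in> split_arcs V T J. extremal_weight n r T J w) = r * extremal_weight n r T J v"
proof -
  have rest: "real (card (V - T - J)) = real n - 4"
    using card_split_rest[of V T J] assms by simp
  have eq: "r * (r - 1) * (r - n + 5) = 4 * (r - n + 5) + 2 * (real n - 4) * r"
    using assms(1) by (simp add: extremal_root_def)
  \<comment> \<open>The rows of \<open>J\<close> and of the rest are identities in \<open>r\<close>;
    the row of \<open>T\<close> is the cubic.\<close>
  show ?thesis
    unfolding extremal_weight_def sum_split_arcs[OF assms(3,5-7,10)] rest assms(8,9)
    using eq by (simp add: split_weight_def algebra_simps)
qed

lemma extremal_root_le_graph_spectral_radius:
  assumes "extremal_root n r" "n \<ge> 5" "pair_graph H" "card (pverts H) = n"
    "parcs H = split_arcs (pverts H) T J"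
    "T \<subseteq> pverts H" "J \<subseteq> pverts H" "T \<inter> J = {}" "card T = 2" "card J = 2"
  shows "r \<le> graph_spectral_radius H"
proof -
  interpret pair_graph H by fact
  obtain u where "u \<in> pverts H" using assms by (metis card.empty equals0I not_numeral_le_zero)
  then show ?thesis
    using extremal_weight_pos[OF assms(1,2), of T J u]
    by (intro eigenvalue_le_graph_spectral_radius[OF assms(3), of u "extremal_weight n r T J"])
      (auto simp: assms(5) intro!: extremal_weight_eigenvector assms pair_finite_verts)
qed

lemma graph_spectral_radius_less_extremal_root:
  assumes "extremal_root n r" "n \<ge> 5" "pair_graph G" "card (pverts G) = n"
    "parcs G \<subset> split_arcs (pverts G) T J"
    "T \<subseteq> pverts G" "J \<subseteq> pverts G" "T \<inter> J = {}" "card T = 2" "card J = 2"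
  shows "graph_spectral_radius G < r"
proof -
  interpret pair_graph G by fact
  let ?V = "pverts G" and ?H = "\<lparr> pverts = pverts G, parcs = split_arcs (pverts G) T J \<rparr>"
  \<comment> \<open>Every vertex of \<open>T\<close> is adjacent to all others in \<open>?H\<close>,
    so it can serve as the universal vertex.\<close>
  obtain a where a: "a \<in> T" using assms by fastforce
  show ?thesis
  proof (rule graph_spectral_radius_less[where H = ?H and a = a and y = "extremal_weight n r T J"])
    show "pair_graph ?H" by (intro pair_graph_split_arcs pair_finite_verts)
    show "(\<Sum>w | (v, w) \<in> parcs ?H. extremal_weight n r T J w) = r * extremal_weight n r T J v"
      if "v \<in> pverts ?H" for v
      using that by (auto intro!: extremal_weight_eigenvector assms pair_finite_verts)
    show "(a, v) \<in> parcs ?H" if "v \<in> pverts ?H" "v \<noteq> a" for v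
      using that a assms by (auto simp: split_arcs_def)
    show "extremal_weight n r T J v > 0" for v
      by (rule extremal_weight_pos) fact+
  qed (use assms a in auto)
qed

text \<open>Adjacency depends only on the classes of two distinct vertices, so bijections between
  corresponding classes glue to an isomorphism.\<close>

lemma digraph_iso_split_arcs:
  assumes "pair_graph G" "pair_graph H" "card (pverts G) = card (pverts H)"
    and G: "parcs G = split_arcs (pverts G) T J" "T \<subseteq> pverts G" "J \<subseteq> pverts G" "T \<inter> J = {}"
    and H: "parcs H = split_arcs (pverts H) T' J'" "T' \<subseteq> pverts H" "J' \<subseteq> pverts H" "T' \<inter> J' = {}"
    and cards: "card T = card T'" "card J = card J'"
  shows "digraph_iso (with_proj G) (with_proj H)"
proof -
  interpret G: pair_graph G by fact
  interpret H: pair_graph H by fact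
  let ?R = "pverts G - T - J" and ?R' = "pverts H - T' - J'"
  have fin: "finite T" "finite J" "finite ?R" "finite T'" "finite J'" "finite ?R'"
    using finite_subset[OF _ G.pair_finite_verts] finite_subset[OF _ H.pair_finite_verts] G H
    by blast+
  have "real (card ?R) = real (card ?R')"
    using card_split_rest[OF G.pair_finite_verts G(2-4)]
      card_split_rest[OF H.pair_finite_verts H(2-4)] assms(3) cards by simp
  then have "card ?R = card ?R'" by simp
  then obtain f1 f2 f3 where f: "bij_betw f1 T T'" "bij_betw f2 J J'" "bij_betw f3 ?R ?R'"
    using cards fin finite_same_card_bij by metis
  define f where "f v = (if v \<in> T then f1 v else if v \<in> J then f2 v else f3 v)" for v
  have "bij_betw f T T'" "bij_betw f J J'" "bij_betw f ?R ?R'"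
    using f G(4) by (auto simp: f_def bij_betw_def inj_on_def image_def)
  then have "bij_betw f (T \<union> J \<union> ?R) (T' \<union> J' \<union> ?R')"
    using H by (intro bij_betw_combine) auto
  moreover have "T \<union> J \<union> ?R = pverts G" "T' \<union> J' \<union> ?R' = pverts H" using G H by auto
  ultimately have bij: "bij_betw f (pverts G) (pverts H)" by simp
  have fT: "f v \<in> T' \<longleftrightarrow> v \<in> T" and fJ: "f v \<in> J' \<longleftrightarrow> v \<in> J" if "v \<in> pverts G" for v
    using that f G(4) H(4) by (auto simp: f_def bij_betw_def)
  have inj: "f v = f w \<longleftrightarrow> v = w" if "v \<in> pverts G" "w \<in> pverts G" for v w
    using that bij by (auto simp: bij_betw_def inj_on_def)
  have arcs: "parcs H = map_prod f f ` parcs G"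
  proof (intro equalityI subrelI)
    fix a b assume ab: "(a, b) \<in> parcs H"
    then have "a \<in> f ` pverts G" "b \<in> f ` pverts G"
      using bij by (auto simp: bij_betw_def dest: H.wellformed')
    then obtain v w where vw: "v \<in> pverts G" "w \<in> pverts G" "a = f v" "b = f w" by blast
    then have "(v, w) \<in> parcs G"
      using ab by (auto simp: G(1) H(1) split_arcs_def fT fJ)
    then show "(a, b) \<in> map_prod f f ` parcs G" using vw by force
  next
    fix a b assume "(a, b) \<in> map_prod f f ` parcs G"
    then obtain v w where vw: "(v, w) \<in> parcs G" "a = f v" "b = f w" by auto
    moreover have "v \<in> pverts G" "w \<in> pverts G" using vw by (auto dest: G.wellformed')
    moreover have "f v \<in> pverts H" "f w \<in> pverts H" using calculation bij by (auto simp: bij_betw_def)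
    ultimately show "(a, b) \<in> parcs H"
      by (auto simp: G(1) H(1) split_arcs_def fT fJ inj)
  qed
  let ?iso = "\<lparr> iso_verts = f, iso_arcs = map_prod f f, iso_head = snd, iso_tail = fst \<rparr>"
  have "inj_on (map_prod f f) (parcs G)"
    using bij by (intro inj_on_subset[OF map_prod_inj_on[of f "pverts G" f "pverts G"]])
      (auto simp: bij_betw_def dest: G.wellformed')
  then have "pre_digraph.digraph_isomorphism (with_proj G) ?iso"
    using bij G.wf_digraph by (simp add: pre_digraph.digraph_isomorphism_def bij_betw_def)
  moreover have "with_proj H = app_iso ?iso (with_proj G)"
    using bij arcs by (simp add: app_iso_def with_proj_def bij_betw_def)
  ultimately show ?thesis unfolding digraph_iso_def by blast
qed

section \<open>Maximal packings by stars with one or two leaves\<close>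

text \<open>Arcs between leaves are allowed: a block may induce a triangle and then has three
  centers, while both ends of an edge are centers.\<close>

definition star_center :: "'a pair_pre_digraph \<Rightarrow> 'a set \<Rightarrow> 'a \<Rightarrow> bool" where
  "star_center G B c \<longleftrightarrow> c \<in> B \<and> (\<forall>v \<in> B - {c}. (c, v) \<in> parcs G)"

text \<open>A star is recorded by its vertex set alone; a center is chosen when needed.\<close>

definition star_packing :: "'a pair_pre_digraph \<Rightarrow> 'a set \<Rightarrow> 'a set set \<Rightarrow> bool" where
  "star_packing G U P \<longleftrightarrow> disjoint P \<and>
     (\<forall>B \<in> P. B \<subseteq> U \<and> (card B = 2 \<or> card B = 3) \<and> (\<exists>c. star_center G B c))"

lemma star_packingD:
  assumes "star_packing G U P" "B \<in> P"
  shows "B \<subseteq> U" "card B = 2 \<or> card B = 3" "\<exists>c. star_center G B c"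
  using assms by (auto simp: star_packing_def)

lemma star_packing_finite_block:
  assumes "star_packing G U P" "B \<in> P"
  shows "finite B"
  using star_packingD(2)[OF assms] by (auto intro: card_ge_0_finite)

lemma star_packing_same_block:
  assumes "star_packing G U P" "B \<in> P" "B' \<in> P" "v \<in> B" "v \<in> B'"
  shows "B = B'"
  using assms by (auto simp: star_packing_def disjoint_def)

lemma star_packing_Union_Diff:
  assumes "star_packing G U P" "Q \<subseteq> P"
  shows "\<Union>(P - Q) = \<Union>P - \<Union>Q"
proof (intro equalityI subsetI)
  fix v assume "v \<in> \<Union>(P - Q)"
  then obtain B where B: "B \<in> P" "B \<notin> Q" "v \<in> B" by blast
  then have "v \<notin> C" if "C \<in> Q" for C
    using star_packing_same_block[OF assms(1) B(1), of C v] assms(2) that by blast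
  then show "v \<in> \<Union>P - \<Union>Q" using B by blast
qed blast

lemma star_packing_replace:
  assumes P: "star_packing G U P" and "Q \<subseteq> P" and R: "star_packing G U R"
    and sub: "\<Union>R \<subseteq> (U - \<Union>P) \<union> \<Union>Q"
  shows "star_packing G U (P - Q \<union> R)"
proof -
  have "disjoint (P - Q)" "disjoint R" "\<Union>(P - Q) \<inter> \<Union>R = {}"
    unfolding star_packing_Union_Diff[OF P \<open>Q \<subseteq> P\<close>]
    using P R sub by (auto simp: star_packing_def disjoint_def)
  then have "disjoint (P - Q \<union> R)" by (rule disjoint_union)
  then show ?thesis using P R by (auto simp: star_packing_def)
qed

lemma star_packing_replace_Union:
  assumes "star_packing G U P" "Q \<subseteq> P"
  shows "\<Union>(P - Q \<union> R) = (\<Union>P - \<Union>Q) \<union> \<Union>R"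
  using star_packing_Union_Diff[OF assms] by auto

text \<open>Measured by covered vertices, so an exchange that keeps their number keeps
  maximality.\<close>

definition max_star_packing :: "'a pair_pre_digraph \<Rightarrow> 'a set \<Rightarrow> 'a set set \<Rightarrow> bool" where
  "max_star_packing G U P \<longleftrightarrow> star_packing G U P \<and>
     (\<forall>P'. star_packing G U P' \<longrightarrow> card (\<Union>P') \<le> card (\<Union>P))"

lemma ex_max_star_packing:
  assumes "finite U"
  shows "\<exists>P. max_star_packing G U P"
proof -
  have "star_packing G U {}" by (simp add: star_packing_def disjoint_def)
  moreover have "card (\<Union>P) \<le> card U" if "star_packing G U P" for P
    using that assms by (intro card_mono) (auto simp: star_packing_def)
  ultimately show ?thesis
    unfolding max_star_packing_def
    by (intro ex_has_greatest_nat[where b = "Suc (card U)"]) (auto simp: less_Suc_eq_le)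
qed

text \<open>Maximality in local form: otherwise replacing \<open>Q\<close> by \<open>R\<close> would
  cover more vertices.\<close>

lemma max_star_packing_replace_card:
  assumes P: "max_star_packing G U P" "finite U" and Q: "Q \<subseteq> P" and R: "star_packing G U R"
    and sub: "\<Union>R \<subseteq> (U - \<Union>P) \<union> \<Union>Q"
  shows "card (\<Union>R) \<le> card (\<Union>Q)"
proof -
  have P': "star_packing G U P" using P by (simp add: max_star_packing_def)
  have fin: "finite (\<Union>P)" "finite (\<Union>R)"
    using P' R by (auto intro!: finite_subset[OF _ assms(2)] simp: star_packing_def)
  have QP: "\<Union>Q \<subseteq> \<Union>P" using Q by auto
  have "card (\<Union>(P - Q \<union> R)) = card (\<Union>P - \<Union>Q) + card (\<Union>R)"
    unfolding star_packing_replace_Union[OF P' Q]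
    using fin sub by (intro card_Un_disjoint) auto
  moreover have "card (\<Union>(P - Q \<union> R)) \<le> card (\<Union>P)"
    using star_packing_replace[OF P' Q R sub] P(1) by (auto simp: max_star_packing_def)
  moreover have "card (\<Union>P - \<Union>Q) = card (\<Union>P) - card (\<Union>Q)" "card (\<Union>Q) \<le> card (\<Union>P)"
    using fin QP by (auto intro: card_Diff_subset card_mono finite_subset)
  ultimately show ?thesis by linarith
qed

text \<open>
  An uncovered vertex adjacent to an uncovered vertex, to a block of size two or to a leaf of a
  block of size three would allow a larger packing.
\<close>

lemma max_star_packing_uncovered_neighbour:
  assumes G: "pair_graph G" and P: "max_star_packing G U P" and U: "U \<subseteq> pverts G"
    and u: "u \<in> U" "u \<notin> \<Union>P" and b: "b \<in> U" "(u, b) \<in> parcs G"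
  obtains B where "B \<in> P" "card B = 3" "b \<in> B" "\<And>c. star_center G B c \<Longrightarrow> c = b"
proof -
  interpret pair_graph G by fact
  have finU: "finite U" using U pair_finite_verts finite_subset by blast
  have P': "star_packing G U P" using P by (simp add: max_star_packing_def)
  have sym: "(v, w) \<in> parcs G" if "(w, v) \<in> parcs G" for v w using that arcs_symmetric by blast
  have "u \<noteq> b" using b(2) no_loops' by blast
  have "b \<in> \<Union>P"
  proof (rule ccontr)
    assume nb: "b \<notin> \<Union>P"
    have "star_center G {u, b} u" using b(2) by (auto simp: star_center_def)
    then have "star_packing G U {{u, b}}"
      using u b \<open>u \<noteq> b\<close> by (auto simp: star_packing_def disjoint_def)
    from max_star_packing_replace_card[OF P finU _ this, of "{}"]
    have "card {u, b} \<le> 0" using u b nb by auto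
    then show False by simp
  qed
  then obtain B where B: "B \<in> P" "b \<in> B" by blast
  have finB: "finite B" and BU: "B \<subseteq> U" and uB: "u \<notin> B"
    using star_packing_finite_block[OF P' B(1)] star_packingD[OF P' B(1)] u B by auto
  have block: "card (\<Union>R) \<le> card B" if "star_packing G U R" "\<Union>R \<subseteq> insert u B" for R
    using max_star_packing_replace_card[OF P finU _ that(1), of "{B}"] that(2) u B by auto
  have "card B \<noteq> 2"
  \<comment> \<open>An edge block could absorb \<open>u\<close> as a second leaf at
    \<open>b\<close>.\<close>
  proof
    assume "card B = 2"
    then obtain b' where b': "B = {b, b'}" "b \<noteq> b'"
      using B(2) by (auto simp: card_2_iff)
    obtain c where "star_center G B c" using star_packingD(3)[OF P' B(1)] by blast
    then have "(b, b') \<in> parcs G" using b' sym by (auto simp: star_center_def)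
    then have "star_center G {u, b, b'} b" using b sym by (auto simp: star_center_def)
    then have "star_packing G U {{u, b, b'}}"
      using u b' uB BU \<open>u \<noteq> b\<close> by (auto simp: star_packing_def disjoint_def)
    from block[OF this] show False using b' uB by auto
  qed
  then have card: "card B = 3" using star_packingD(2)[OF P' B(1)] by simp
  moreover have "c = b" if c: "star_center G B c" for c
  \<comment> \<open>If \<open>b\<close> were a leaf, \<open>B\<close> together with \<open>u\<close>
    would split into the edges \<open>{u, b}\<close> and \<open>{c, d}\<close>, covering one more
    vertex.\<close>
  proof (rule ccontr)
    assume "c \<noteq> b"
    have "card (B - {b, c}) = 1"
      using card finB c B \<open>c \<noteq> b\<close> by (simp add: star_center_def card_Diff_subset)
    then obtain d where "B - {b, c} = {d}" by (auto simp: card_1_singleton_iff)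
    then have d: "B = {b, c, d}" "d \<noteq> b" "d \<noteq> c" using B(2) c by (auto simp: star_center_def)
    have "star_center G {u, b} u" "star_center G {c, d} c"
      using b c d by (auto simp: star_center_def)
    then have "star_packing G U {{u, b}, {c, d}}"
      using u b d uB BU \<open>u \<noteq> b\<close> \<open>c \<noteq> b\<close> by (auto simp: star_packing_def disjoint_def)
    from block[OF this] have "card {u, b, c, d} \<le> card B" using d by (auto simp: insert_commute)
    moreover have "card {u, b, c, d} = card (insert u B)" using d by simp
    ultimately show False using uB finB by simp
  qed
  ultimately show thesis using that B by blast
qed

lemma card_star_packing_Union:
  assumes "star_packing G U P" "finite U"
  shows "card (\<Union>P) = 3 * card {B \<in> P. card B = 3} + 2 * card {B \<in> P. card B = 2}"
proof -
  have finP: "finite P"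
    using assms finite_subset[of P "Pow U"] by (auto simp: star_packing_def)
  have "card (\<Union>P) = (\<Sum>B\<in>P. card B)"
    using assms star_packing_finite_block[OF assms(1)]
    by (intro card_Union_disjoint) (auto simp: star_packing_def disjoint_def pairwise_def disjnt_def)
  also have "\<dots> = (\<Sum>B\<in>P. if card B = 3 then 3 else 0) + (\<Sum>B\<in>P. if card B = 2 then 2 else 0)"
    unfolding sum.distrib[symmetric]
    using star_packingD(2)[OF assms(1)] by (intro sum.cong) auto
  also have "\<dots> = 3 * card {B \<in> P. card B = 3} + 2 * card {B \<in> P. card B = 2}"
    using finP by (simp add: sum.inter_filter[symmetric])
  finally show ?thesis .
qed

text \<open>
  Let \<open>b\<close> be a neighbour of an uncovered vertex \<open>u\<close>. Exchanging \<open>u\<close> with a leaf of the block with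
  center \<open>b\<close> gives another maximal packing, so the leaves of that block are, like \<open>u\<close>, adjacent only
  to centers of blocks of size three.
\<close>

lemma star_packing_obstruction:
  assumes G: "pair_graph G" and U: "U \<subseteq> pverts G"
    and deg: "\<And>u. u \<in> U \<Longrightarrow> \<exists>w \<in> U. (u, w) \<in> parcs G"
    and none: "\<And>P. star_packing G U P \<Longrightarrow> \<Union>P \<noteq> U"
  obtains J W where "J \<subseteq> U" "W \<subseteq> U" "W \<inter> J = {}"
    "\<And>v w. v \<in> J \<Longrightarrow> w \<in> U \<Longrightarrow> (v, w) \<in> parcs G \<Longrightarrow> w \<in> W"
    "card J = 3 \<and> (\<exists>d. card U = 1 + 3 * card W + 2 * d) \<or> card J = 4 \<and> 3 * card W + 2 \<le> card U"
proof -
  interpret pair_graph G by fact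
  have finU: "finite U" using U pair_finite_verts finite_subset by blast
  obtain P where maxP: "max_star_packing G U P" using ex_max_star_packing[OF finU] by blast
  then have P: "star_packing G U P" by (simp add: max_star_packing_def)
  define X where "X = U - \<Union>P"
  have PU: "\<Union>P \<subseteq> U" using P by (auto simp: star_packing_def)
  have "X \<noteq> {}" using none[OF P] PU by (auto simp: X_def)
  then obtain u where u: "u \<in> U" "u \<notin> \<Union>P" by (auto simp: X_def)
  \<comment> \<open>An arbitrary choice, but forced in a block that contains a neighbour of an
    uncovered vertex: there the center is unique.\<close>
  define cen where "cen B = (SOME c. star_center G B c)" for B
  have cen: "star_center G B (cen B)" if "B \<in> P" for B
    unfolding cen_def using star_packingD(3)[OF P that] by (rule someI_ex)
  then have cenB: "cen B \<in> B" if "B \<in> P" for B using that by (auto simp: star_center_def)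
  let ?P3 = "{B \<in> P. card B = 3}"
  define W where "W = cen ` ?P3"
  have injW: "inj_on cen ?P3"
    using cenB star_packing_same_block[OF P] by (intro inj_onI) (metis (no_types, lifting) mem_Collect_eq)
  have WP: "W \<subseteq> \<Union>P" using cenB by (auto simp: W_def)
  have cardW: "card W = card ?P3" unfolding W_def by (rule card_image) fact
  \<comment> \<open>With \<open>card X = 1\<close> this yields the exact form of
    \<open>card U\<close>, with \<open>card X \<ge> 2\<close> the inequality.\<close>
  have cardU: "card U = card X + 3 * card W + 2 * card {B \<in> P. card B = 2}"
  proof -
    have "card X = card U - card (\<Union>P)" "card (\<Union>P) \<le> card U"
      unfolding X_def using PU finU finite_subset[OF PU finU]
      by (auto intro: card_Diff_subset card_mono)
    then show ?thesis using card_star_packing_Union[OF P finU] cardW by simp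
  qed
  have X_nb: "w \<in> W" if vw: "v \<in> X" "w \<in> U" "(v, w) \<in> parcs G" for v w
  proof -
    have "v \<in> U" "v \<notin> \<Union>P" using vw(1) by (auto simp: X_def)
    then obtain B where B: "B \<in> P" "card B = 3" "\<And>c. star_center G B c \<Longrightarrow> c = w"
      using max_star_packing_uncovered_neighbour[OF G maxP U _ _ vw(2,3)] by blast
    then have "cen B = w" by (intro B(3) cen)
    then show ?thesis using B by (auto simp: W_def)
  qed
  obtain b where b: "b \<in> U" "(u, b) \<in> parcs G" using deg[OF u(1)] by blast
  obtain B where B: "B \<in> P" "card B = 3" "b \<in> B" "\<And>c. star_center G B c \<Longrightarrow> c = b"
    using max_star_packing_uncovered_neighbour[OF G maxP U u b] by blast
  have cB: "star_center G B b" using B(4) cen[OF B(1)] by metis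
  have "b \<in> W" using X_nb u b by (auto simp: X_def)
  have finB: "finite B" and BU: "B \<subseteq> U" and uB: "u \<notin> B"
    using star_packing_finite_block[OF P B(1)] star_packingD[OF P B(1)] u B by auto
  have leaf_nb: "w \<in> W" if p: "p \<in> B - {b}" and w: "w \<in> U" "(p, w) \<in> parcs G" for p w
  proof -
    \<comment> \<open>\<open>u\<close> takes the place of the leaf \<open>p\<close>. The new packing
      covers as many vertices and leaves \<open>p\<close> uncovered, so the neighbour
      \<open>w\<close> of \<open>p\<close> is the only center of a block of size three in
      it.\<close>
    let ?B = "insert u (B - {p})"
    have cardB: "card ?B = 3" using uB finB p B(2) by simp
    have cB': "star_center G ?B b"
      using cB b(2) arcs_symmetric p by (auto simp: star_center_def)
    then have R: "star_packing G U {?B}"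
      using u BU cardB by (auto simp: star_packing_def disjoint_def)
    have sub: "\<Union>{?B} \<subseteq> (U - \<Union>P) \<union> \<Union>{B}" using u by auto
    let ?P' = "P - {B} \<union> {?B}"
    have P': "star_packing G U ?P'" using B(1) by (intro star_packing_replace[OF P _ R sub]) blast
    have UP': "\<Union>?P' = (\<Union>P - \<Union>{B}) \<union> \<Union>{?B}"
      using B(1) by (intro star_packing_replace_Union[OF P]) blast
    then have "\<Union>?P' = insert u (\<Union>P - {p})" using p B(1) by auto
    moreover have "card (insert u (\<Union>P - {p})) = card (\<Union>P)"
    proof -
      have "finite (\<Union>P)" "p \<in> \<Union>P" using PU finU finite_subset p B(1) by auto
      then show ?thesis using card.remove[of "\<Union>P" p] u by simp
    qed
    ultimately have "card (\<Union>?P') = card (\<Union>P)" by simp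
    then have maxP': "max_star_packing G U ?P'"
      using maxP P' by (auto simp: max_star_packing_def)
    have p': "p \<in> U" "p \<notin> \<Union>?P'" using p BU \<open>\<Union>?P' = insert u (\<Union>P - {p})\<close> uB by auto
    obtain C where C: "C \<in> ?P'" "card C = 3" "\<And>c. star_center G C c \<Longrightarrow> c = w"
      using max_star_packing_uncovered_neighbour[OF G maxP' U p' w] by blast
    show ?thesis
    proof (cases "C = ?B")
      case True
      then show ?thesis using C(3) cB' \<open>b \<in> W\<close> by metis
    next
      case False
      then have "C \<in> P" using C(1) by blast
      moreover from this have "cen C = w" by (intro C(3) cen)
      ultimately show ?thesis using C(2) by (auto simp: W_def)
    qed
  qed
  have cardL: "card (B - {b}) = 2" using B finB by simp
  have WL: "W \<inter> (B - {b}) = {}"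
  proof -
    \<comment> \<open>Blocks are disjoint, so a chosen center lying in \<open>B\<close> is that of
      \<open>B\<close> itself.\<close>
    have "v = b" if v: "v \<in> W" "v \<in> B" for v
    proof -
      obtain C where C: "C \<in> P" "v = cen C" using v(1) by (auto simp: W_def)
      then have "C = B" using star_packing_same_block[OF P C(1) B(1) cenB] v(2) by simp
      then show ?thesis using C(2) B(4)[OF cen[OF B(1)]] by simp
    qed
    then show ?thesis by auto
  qed
  have finX: "finite X" using finU by (simp add: X_def)
  have XB: "X \<inter> B = {}" using B(1) by (auto simp: X_def)
  show thesis
  proof (cases "card X = 1")
    case True
    moreover have "u \<in> X" using u by (simp add: X_def)
    ultimately have Xu: "X = {u}" by (auto simp: card_1_singleton_iff)
    show thesis
    proof (rule that[of "insert u (B - {b})" W])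
      show "card (insert u (B - {b})) = 3 \<and> (\<exists>d. card U = 1 + 3 * card W + 2 * d) \<or>
          card (insert u (B - {b})) = 4 \<and> 3 * card W + 2 \<le> card U"
        using cardL uB finB cardU True by auto
      show "w \<in> W" if "v \<in> insert u (B - {b})" "w \<in> U" "(v, w) \<in> parcs G" for v w
        using that X_nb leaf_nb Xu by auto
    qed (use u BU WP PU WL in auto)
  next
    case False
    moreover have "card X \<noteq> 0" using finX \<open>X \<noteq> {}\<close> by simp
    ultimately have "card X \<ge> 2" by linarith
    \<comment> \<open>Two uncovered vertices and the two leaves of \<open>B\<close> give four
      vertices.\<close>
    then obtain Y where Y: "Y \<subseteq> X" "card Y = 2" by (meson obtain_subset_with_card_n)
    then have finY: "finite Y" using finX finite_subset by blast
    show thesis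
    proof (rule that[of "Y \<union> (B - {b})" W])
      have "card (Y \<union> (B - {b})) = 4"
        using Y finY finB cardL XB by (subst card_Un_disjoint) auto
      then show "card (Y \<union> (B - {b})) = 3 \<and> (\<exists>d. card U = 1 + 3 * card W + 2 * d) \<or>
          card (Y \<union> (B - {b})) = 4 \<and> 3 * card W + 2 \<le> card U"
        using cardU \<open>card X \<ge> 2\<close> by auto
      show "w \<in> W" if "v \<in> Y \<union> (B - {b})" "w \<in> U" "(v, w) \<in> parcs G" for v w
        using that X_nb leaf_nb Y by auto
    qed (use Y BU WP PU WL in \<open>auto simp: X_def\<close>)
  qed
qed

section \<open>Star factors from perfect packings\<close>

text \<open>Arcs between leaves are left out, so a block inducing a triangle still becomes a
  star.\<close>

definition star_forest :: "'a set set \<Rightarrow> ('a set \<Rightarrow> 'a) \<Rightarrow> 'a pair_pre_digraph" where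
  "star_forest P cen = \<lparr> pverts = \<Union>P,
     parcs = (\<Union>B\<in>P. {cen B} \<times> (B - {cen B}) \<union> (B - {cen B}) \<times> {cen B}) \<rparr>"

text \<open>No arc leaves its block, and within a block all vertices reach each other through the
  center; hence the blocks are exactly the components.\<close>

lemma star_forest_components:
  assumes G: "pair_graph G" and P: "star_packing G (pverts G) P"
    and cen: "\<And>B. B \<in> P \<Longrightarrow> star_center G B (cen B)"
  defines "F \<equiv> star_forest P cen"
  shows "pair_graph F" "parcs F \<subseteq> parcs G"
    "graph_components F = (\<restriction>) (with_proj F) ` P"
    "\<And>B. B \<in> P \<Longrightarrow> complete_bipartite_digraph 1 (card B - 1) (with_proj F \<restriction> B)"
proof -
  interpret G: pair_graph G by fact
  have cenB: "cen B \<in> B" if "B \<in> P" for B using cen[OF that] by (simp add: star_center_def)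
  show sub: "parcs F \<subseteq> parcs G"
    using cen G.arcs_symmetric by (force simp: F_def star_forest_def star_center_def)
  have PV: "\<Union>P \<subseteq> pverts G" using P by (auto simp: star_packing_def)
  show "pair_graph F"
  proof unfold_locales
    show "finite (pverts F)"
      using finite_subset[OF PV G.pair_finite_verts] by (simp add: F_def star_forest_def)
    show "finite (parcs F)" using sub G.pair_finite_arcs finite_subset by blast
    show "fst e \<noteq> snd e" if "e \<in> parcs F" for e
      using that sub G.pair_no_loops by blast
    have "\<exists>A\<in>P. cen B \<in> A" if "B \<in> P" for B using cenB[OF that] that by blast
    then show "fst e \<in> pverts F" "snd e \<in> pverts F" if "e \<in> parcs F" for e
      using that by (auto simp: F_def star_forest_def)
  qed (auto simp: F_def star_forest_def symmetric_def sym_def)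
  then interpret F: pair_graph F .
  have adj: "w \<in> B" if "(v, w) \<in> parcs F" "v \<in> B" "B \<in> P" for v w B
    using that cenB star_packing_same_block[OF P that(3)]
    by (fastforce simp: F_def star_forest_def)
  have reach: "w \<in> B" if vw: "v \<rightarrow>\<^sup>*\<^bsub>with_proj F\<^esub> w" and vB: "v \<in> B" "B \<in> P" for v w B
    using vw
  proof (induction rule: F.reachable_induct)
    case base
    show ?case by (rule vB)
  next
    case (step x y)
    then show ?case using adj vB(2) by simp
  qed
  have scc: "B \<in> F.sccs_verts" if B: "B \<in> P" for B
    unfolding F.in_sccs_verts_conv_reachable
  proof (intro conjI ballI allI impI)
    have BF: "B \<subseteq> pverts F" using B by (auto simp: F_def star_forest_def)
    have "v \<rightarrow>\<^sup>*\<^bsub>with_proj F\<^esub> cen B \<and> cen B \<rightarrow>\<^sup>*\<^bsub>with_proj F\<^esub> v" if "v \<in> B" for v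
    proof (cases "v = cen B")
      case True
      then show ?thesis using BF that by auto
    next
      case False
      then have "(v, cen B) \<in> parcs F" "(cen B, v) \<in> parcs F"
        using that B by (auto simp: F_def star_forest_def)
      then show ?thesis by (auto intro: F.reachable_adjI)
    qed
    then show "u \<rightarrow>\<^sup>*\<^bsub>with_proj F\<^esub> v" if "u \<in> B" "v \<in> B" for u v
      using that F.reachable_trans by blast
    show "B \<noteq> {}" using cenB[OF B] by blast
    show "\<not> u \<rightarrow>\<^sup>*\<^bsub>with_proj F\<^esub> v \<or> \<not> v \<rightarrow>\<^sup>*\<^bsub>with_proj F\<^esub> u" if "u \<in> B" "v \<notin> B" for u v
      using reach[OF _ that(1) B] that(2) by blast
  qed
  have "S \<in> P" if S: "S \<in> F.sccs_verts" for S
  proof -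
    have "S \<noteq> {}" using S by (simp add: F.in_sccs_verts_conv_reachable)
    then obtain u where u: "u \<in> S" by blast
    then have "u \<in> pverts F" using F.sccs_verts_subsets[OF S] by auto
    then obtain B where B: "B \<in> P" "u \<in> B" by (auto simp: F_def star_forest_def)
    then have "S = B" using F.sccs_verts_disjoint[OF S scc[OF B(1)]] u by blast
    then show ?thesis using B by simp
  qed
  then have "F.sccs_verts = P" using scc by blast
  then show "graph_components F = (\<restriction>) (with_proj F) ` P"
    unfolding graph_components_def F.sccs_conv_sccs_verts by simp
  show "complete_bipartite_digraph 1 (card B - 1) (with_proj F \<restriction> B)" if B: "B \<in> P" for B
  proof -
    let ?c = "cen B"
    let ?S = "\<lparr> pverts = B, parcs = {?c} \<times> (B - {?c}) \<union> (B - {?c}) \<times> {?c} \<rparr>"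
    have finB: "finite B" by (rule star_packing_finite_block[OF P B])
    \<comment> \<open>By disjointness, an arc starting in \<open>B\<close> can only come from the
      star of \<open>B\<close>.\<close>
    have "{e \<in> parcs F. fst e \<in> B \<and> snd e \<in> B} = parcs ?S"
    proof (intro equalityI subsetI)
      fix e assume "e \<in> {e \<in> parcs F. fst e \<in> B \<and> snd e \<in> B}"
      then obtain C where C: "C \<in> P" "e \<in> {cen C} \<times> (C - {cen C}) \<union> (C - {cen C}) \<times> {cen C}"
        and eB: "fst e \<in> B"
        by (auto simp: F_def star_forest_def)
      then have "fst e \<in> C" using cenB[OF C(1)] by auto
      then have "C = B" using star_packing_same_block[OF P C(1) B] eB by blast
      then show "e \<in> parcs ?S" using C by simp
    qed (use B cenB[OF B] in \<open>auto simp: F_def star_forest_def\<close>)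
    then have "with_proj F \<restriction> B = with_proj ?S"
      by (simp add: induce_subgraph_def with_proj_def)
    moreover have "complete_bipartite_digraph 1 (card B - 1) (with_proj ?S)"
      unfolding complete_bipartite_digraph_pair_def
      by (intro conjI, use finB in simp, rule exI[of _ "{?c}"], rule exI[of _ "B - {?c}"])
        (use finB cenB[OF B] in auto)
    ultimately show ?thesis by simp
  qed
qed

lemma S_factor_of_star_packing:
  assumes G: "pair_graph G" and P: "star_packing G (pverts G) P" "\<Union>P = pverts G" and k: "k \<ge> 2"
    and B: "B \<in> P" "star_center G B c" and e: "(u, v) \<in> {c} \<times> (B - {c}) \<union> (B - {c}) \<times> {c}"
  shows "\<exists>F. S_factor k F G \<and> (\<exists>C \<in> graph_components F. (u, v) \<in> arcs C \<and>
    (complete_bipartite_digraph 1 1 C \<or> complete_bipartite_digraph 1 2 C))"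
proof -
  interpret G: pair_graph G by fact
  \<comment> \<open>The update imposes the prescribed center on \<open>B\<close>, so that the arc
    \<open>(u, v)\<close> belongs to the forest.\<close>
  define cen where "cen = (\<lambda>A. SOME c. star_center G A c)(B := c)"
  have cen: "star_center G A (cen A)" if "A \<in> P" for A
    using star_packingD(3)[OF P(1) that] B(2) by (auto simp: cen_def intro: someI_ex)
  let ?F = "star_forest P cen"
  note F = star_forest_components[OF G P(1) cen]
  interpret F: pair_graph ?F using F(1) by blast
  have "is_factor ?F G"
    unfolding is_factor_def spanning_def subgraph_def
    using F(1,2) P(2) G.wf_digraph F.wf_digraph
    by (auto simp: star_forest_def compatible_def)
  moreover have "\<exists>m\<in>{1..k}. complete_bipartite_digraph 1 m C" if "C \<in> graph_components ?F" for C
  proof -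
    obtain A where A: "A \<in> P" "C = with_proj ?F \<restriction> A" using \<open>C \<in> _\<close> F(3) by blast
    then have "card A - 1 \<in> {1..k}" using star_packingD(2)[OF P(1), of A] k by auto
    then show ?thesis using F(4)[of A] A by blast
  qed
  ultimately have "S_factor k ?F G" by (simp add: S_factor_def)
  moreover have "with_proj ?F \<restriction> B \<in> graph_components ?F" using F(3) B(1) by blast
  moreover have "(u, v) \<in> arcs (with_proj ?F \<restriction> B)"
    using e B cen[OF B(1)] by (auto simp: star_forest_def cen_def star_center_def)
  moreover have "complete_bipartite_digraph 1 1 (with_proj ?F \<restriction> B) \<or>
      complete_bipartite_digraph 1 2 (with_proj ?F \<restriction> B)"
    using F(4)[of B] B(1) star_packingD(2)[OF P(1) B(1)] by auto
  ultimately show ?thesis by blast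
qed

section \<open>The extremal graph\<close>

lemma extremal_graph_split:
  fixes n :: nat
  assumes "n \<ge> 4"
  defines "H \<equiv> graph_join (complete_graph 2)
    (disjoint_union (graph_copies 2 (complete_graph 1)) (complete_graph (n - 4)))"
  obtains T J where "pair_graph H" "card (pverts H) = n" "parcs H = split_arcs (pverts H) T J"
    "T \<subseteq> pverts H" "J \<subseteq> pverts H" "T \<inter> J = {}" "card T = 2" "card J = 2"
proof -
  \<comment> \<open>\<open>?T\<close> is the copy of \<open>K_2\<close>, \<open>?J\<close> the two
    isolated vertices and \<open>?R\<close> the large clique.\<close>
  let ?T = "Inl ` {..<2::nat} :: (nat + (nat \<times> nat + nat)) set"
  let ?J = "Inr ` Inl ` ({..<2} \<times> {..<1}) :: (nat + (nat \<times> nat + nat)) set"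
  let ?R = "Inr ` Inr ` {..<n - 4} :: (nat + (nat \<times> nat + nat)) set"
  have V: "pverts H = ?T \<union> (?J \<union> ?R)"
    by (simp add: H_def graph_join_def disjoint_union_def graph_copies_def complete_graph_def image_Un)
  have T: "card ?T = 2" by (subst card_image) auto
  have J: "card ?J = 2" by (subst card_image, simp, subst card_image) auto
  have R: "card ?R = n - 4" by (subst card_image, simp, subst card_image) auto
  have "card (pverts H) = card ?T + (card ?J + card ?R)"
    unfolding V by (subst card_Un_disjoint; (subst card_Un_disjoint)?) auto
  then have "card (pverts H) = n" using T J R assms by simp
  moreover have "pair_graph H"
    unfolding H_def
    by (intro pair_graph_graph_join pair_graph_disjoint_union pair_graph_graph_copies
        pair_graph_complete_graph)
  moreover have "parcs H = split_arcs (pverts H) ?T ?J"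
    unfolding V
    by (auto simp: H_def split_arcs_def graph_join_def disjoint_union_def graph_copies_def
        complete_graph_def image_iff)
  ultimately show thesis using T J V by (intro that[of ?T ?J]) auto
qed

text \<open>
  The numerical condition of \<open>graph_spectral_radius_split_le\<close> for \<open>\<bar>T\<bar> = c + 2\<close> and
  \<open>\<bar>J\<bar> = 3, 4, 5\<close>. For \<open>\<bar>J\<bar> = 3\<close> it fails at \<open>n = 10\<close>, \<open>c = 2\<close>, which the exact value of \<open>n\<close>
  excludes by parity.
\<close>

lemma obstruction_bounds:
  fixes c d n :: nat
  assumes "n \<ge> 10"
  shows "n = 3 + 3 * c + 2 * d \<Longrightarrow>
      3 * (real c + 2) * (real c + 2 + 3 - 2) \<le> (3 - 2) * ((real n - 2) * (real n - 3))"
    and "3 * c + 4 \<le> n \<Longrightarrow>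
      4 * (real c + 2) * (real c + 2 + 4 - 2) \<le> (4 - 2) * ((real n - 2) * (real n - 3))"
    and "3 * c + 5 \<le> n \<Longrightarrow>
      5 * (real c + 2) * (real c + 2 + 5 - 2) \<le> (5 - 2) * ((real n - 2) * (real n - 3))"
proof -
  define N where "N = (real n - 2) * (real n - 3)"
  note N = N_def[symmetric]
  have mono: "(a - 2) * (a - 3) \<le> N" if "a \<le> n" "a \<ge> 3" for a
    unfolding N_def using that by (intro mult_mono) auto
  \<comment> \<open>With \<open>c = m + 3\<close> the differences of the compared products are
    polynomials in \<open>m\<close> with nonnegative coefficients; smaller \<open>c\<close> are
    settled by \<open>n \<ge> 10\<close>.\<close>
  consider "c \<le> 1" | "c = 2" | m where "c = m + 3"
  proof (cases "c \<ge> 3")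
    case True
    then have "c = (c - 3) + 3" by simp
    then show ?thesis by (rule that(3))
  next
    case False
    then have "c \<le> 1 \<or> c = 2" by linarith
    then show ?thesis using that(1,2) by blast
  qed
  note c_cases = this
  show "3 * (real c + 2) * (real c + 2 + 3 - 2) \<le> (3 - 2) * ((real n - 2) * (real n - 3))"
    if "n = 3 + 3 * c + 2 * d"
  proof (cases rule: c_cases)
    case 1
    then have "c = 0 \<or> c = 1" by auto
    then show ?thesis unfolding N using mono[of 10] assms by auto
  next
    case 2
    \<comment> \<open>Here \<open>n = 9 + 2 * d\<close> is odd.\<close>
    then have "n \<ge> 11" using that assms by presburger
    then show ?thesis unfolding N using mono[of 11] 2 by auto
  next
    case (3 m)
    have "(real (3 * c + 3) - 2) * (real (3 * c + 3) - 3) \<le> N"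
      using that by (intro mono) auto
    \<comment> \<open>This is an equality at \<open>m = 0\<close>.\<close>
    moreover have "3 * (real c + 2) * (real c + 3) \<le> (real (3 * c + 3) - 2) * (real (3 * c + 3) - 3)"
      by (simp add: 3 algebra_simps)
    ultimately show ?thesis unfolding N by (simp add: algebra_simps)
  qed
  show "4 * (real c + 2) * (real c + 2 + 4 - 2) \<le> (4 - 2) * ((real n - 2) * (real n - 3))"
    if "3 * c + 4 \<le> n"
  proof (cases rule: c_cases)
    case 1
    then have "c = 0 \<or> c = 1" by auto
    then show ?thesis unfolding N using mono[of 10] assms by auto
  next
    case 2
    then show ?thesis unfolding N using mono[of 10] assms by auto
  next
    case (3 m)
    have "(real (3 * c + 4) - 2) * (real (3 * c + 4) - 3) \<le> N"
      using that by (intro mono) auto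
    moreover have "2 * (real c + 2) * (real c + 4) \<le> (real (3 * c + 4) - 2) * (real (3 * c + 4) - 3)"
      by (simp add: 3 algebra_simps)
    ultimately show ?thesis unfolding N by (simp add: algebra_simps)
  qed
  show "5 * (real c + 2) * (real c + 2 + 5 - 2) \<le> (5 - 2) * ((real n - 2) * (real n - 3))"
    if "3 * c + 5 \<le> n"
  proof (cases rule: c_cases)
    case 1
    then have "c = 0 \<or> c = 1" by auto
    then show ?thesis unfolding N using mono[of 10] assms by auto
  next
    case 2
    then show ?thesis unfolding N using mono[of 10] assms by auto
  next
    case (3 m)
    have "(real (3 * c + 5) - 2) * (real (3 * c + 5) - 3) \<le> N"
      using that by (intro mono) auto
    moreover have "5 * (real c + 2) * (real c + 5) \<le> 3 * ((real (3 * c + 5) - 2) * (real (3 * c + 5) - 3))"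
      by (simp add: 3 algebra_simps)
    ultimately show ?thesis unfolding N by (simp add: algebra_simps)
  qed
qed

section \<open>Obstructions to extending the prescribed star\<close>

lemma graph_spectral_radius_less_if_neighbours_subset:
  assumes G: "pair_graph G" and r: "extremal_root n r" and n: "card (pverts G) = n" "n \<ge> 10"
    and TJ: "T \<subseteq> pverts G" "J \<subseteq> pverts G" "T \<inter> J = {}" "T \<noteq> {}" "card J \<ge> 3"
    and nb: "\<And>v w. v \<in> J \<Longrightarrow> (v, w) \<in> parcs G \<Longrightarrow> w \<in> T"
    and bound: "real (card J) * real (card T) * (real (card T) + real (card J) - 2)
      \<le> (real (card J) - 2) * ((real n - 2) * (real n - 3))"
  shows "graph_spectral_radius G < r"
proof -
  interpret pair_graph G by fact
  have "parcs G \<subseteq> split_arcs (pverts G) T J"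
  proof (intro subrelI)
    fix v w assume vw: "(v, w) \<in> parcs G"
    then have "(w, v) \<in> parcs G" "v \<noteq> w" using arcs_symmetric no_loops' by auto
    then show "(v, w) \<in> split_arcs (pverts G) T J"
      using vw nb[of v w] nb[of w v] by (auto simp: split_arcs_def dest: wellformed')
  qed
  moreover have "card T \<ge> 1"
    using TJ finite_subset[OF TJ(1) pair_finite_verts] by (simp add: card_gt_0_iff Suc_le_eq)
  ultimately have "graph_spectral_radius G \<le> real n - 3"
    using TJ n bound by (intro graph_spectral_radius_split_le[OF G]) auto
  then show ?thesis using r by (simp add: extremal_root_def)
qed

text \<open>\<open>B\<close> is the star that is to contain the arc \<open>(u, v)\<close>.\<close>

lemma small_star_extends_to_packing:
  assumes G: "pair_graph G" and r: "extremal_root n r" "r \<le> graph_spectral_radius G"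
    and n: "card (pverts G) = n" "n \<ge> 10"
    and uv: "u \<in> pverts G" "v \<in> pverts G" "u \<noteq> v"
    and B: "B = {u, v} \<or> B = {u, v, x} \<and> x \<in> pverts G \<and> x \<notin> {u, v} \<and>
      (\<forall>w. (x, w) \<in> parcs G \<longrightarrow> w \<in> {u, v})"
    and c: "star_center G B c"
    and deg: "\<And>y. y \<in> pverts G - B \<Longrightarrow> \<exists>w \<in> pverts G - B. (y, w) \<in> parcs G"
  shows "\<exists>P. star_packing G (pverts G) P \<and> \<Union>P = pverts G \<and> B \<in> P"
proof -
  interpret pair_graph G by fact
  let ?U = "pverts G - B"
  have BV: "B \<subseteq> pverts G" using B uv by auto
  have finB: "finite B" using B by auto
  have cardB: "card B = 2 \<or> card B = 3" using B uv by auto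
  have cardU: "card ?U = n - card B" using n(1) BV finB by (simp add: card_Diff_subset)
  have "\<exists>P. star_packing G ?U P \<and> \<Union>P = ?U"
  proof (rule ccontr)
    assume "\<not> ?thesis"
    then have none: "\<And>P. star_packing G ?U P \<Longrightarrow> \<Union>P \<noteq> ?U" by blast
    obtain J W where JW: "J \<subseteq> ?U" "W \<subseteq> ?U" "W \<inter> J = {}"
      and nb: "\<And>v w. v \<in> J \<Longrightarrow> w \<in> ?U \<Longrightarrow> (v, w) \<in> parcs G \<Longrightarrow> w \<in> W"
      and card: "card J = 3 \<and> (\<exists>d. card ?U = 1 + 3 * card W + 2 * d) \<or>
        card J = 4 \<and> 3 * card W + 2 \<le> card ?U"
      using star_packing_obstruction[OF G _ deg none] by blast
    \<comment> \<open>The third vertex of \<open>B\<close>, if present, has neighbours only among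
      \<open>u\<close> and \<open>v\<close>, so it may join \<open>J\<close>. Vertices of
      \<open>J\<close> may be adjacent to \<open>u\<close> and \<open>v\<close>, which therefore
      join \<open>W\<close>.\<close>
    define J' where "J' = J \<union> (B - {u, v})"
    let ?T = "W \<union> {u, v}"
    have fin: "finite J" "finite W"
      using JW finite_subset[OF _ pair_finite_verts] by blast+
    have uvB: "u \<in> B" "v \<in> B" using B by auto
    have cardT: "card ?T = card W + 2"
      using fin JW uv uvB by (subst card_Un_disjoint) auto
    have cardJ': "card J' = card J + (card B - 2)"
      unfolding J'_def using fin finB JW uv uvB
      by (subst card_Un_disjoint) (auto simp: card_Diff_subset)
    have T: "?T \<subseteq> pverts G" "J' \<subseteq> pverts G" "?T \<inter> J' = {}" "?T \<noteq> {}" "card J' \<ge> 3"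
      using JW BV uv uvB card cardJ' by (auto simp: J'_def)
    have "w \<in> ?T" if "y \<in> J'" "(y, w) \<in> parcs G" for y w
    proof (cases "y \<in> J")
      case True
      have "w \<in> pverts G" "(w, y) \<in> parcs G"
        using that(2) arcs_symmetric by (auto dest: wellformed')
      \<comment> \<open>A neighbour \<open>w = x\<close> is impossible, since all neighbours of
        \<open>x\<close> are \<open>u\<close> or \<open>v\<close> and \<open>y\<close> is outside
        \<open>B\<close>.\<close>
      moreover have "w \<in> {u, v}" if "w \<in> B"
        using that B \<open>(w, y) \<in> parcs G\<close> True JW uvB by auto
      ultimately show ?thesis using nb[OF True _ that(2)] by blast
    next
      case False
      then show ?thesis using that B by (auto simp: J'_def)
    qed
    moreover have "real (card J') * real (card ?T) * (real (card ?T) + real (card J') - 2)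
        \<le> (real (card J') - 2) * ((real n - 2) * (real n - 3))"
    proof -
      note bounds = obstruction_bounds[OF n(2), of "card W"]
      consider (a) d where "card J = 3" "card ?U = 1 + 3 * card W + 2 * d"
        | (b) "card J = 4" "3 * card W + 2 \<le> card ?U"
        using card by blast
      then show ?thesis
      \<comment> \<open>The sizes 3 and 4 of \<open>J\<close>, combined with 2 and 3 of
        \<open>B\<close>, give \<open>card J'\<close> = 3, 4, 4, 5. The exact value of
        \<open>n\<close> is kept for size 3, where parity matters.\<close>
      proof cases
        case (a d)
        show ?thesis
        proof (cases "card B = 2")
          case True
          then have J: "card J' = 3" "n = 3 + 3 * card W + 2 * d" using a cardJ' cardU n(2) by auto
          show ?thesis
            unfolding cardT J(1) using bounds(1)[OF J(2)] by (simp only: of_nat_add of_nat_numeral)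
        next
          case False
          then have J: "card J' = 4" "3 * card W + 4 \<le> n" using a cardJ' cardU n(2) cardB by auto
          show ?thesis
            unfolding cardT J(1) using bounds(2)[OF J(2)] by (simp only: of_nat_add of_nat_numeral)
        qed
      next
        case b
        show ?thesis
        proof (cases "card B = 2")
          case True
          then have J: "card J' = 4" "3 * card W + 4 \<le> n" using b cardJ' cardU n(2) by auto
          show ?thesis
            unfolding cardT J(1) using bounds(2)[OF J(2)] by (simp only: of_nat_add of_nat_numeral)
        next
          case False
          then have J: "card J' = 5" "3 * card W + 5 \<le> n" using b cardJ' cardU n(2) cardB by auto
          show ?thesis
            unfolding cardT J(1) using bounds(3)[OF J(2)] by (simp only: of_nat_add of_nat_numeral)
        qed
      qed
    qed
    ultimately have "graph_spectral_radius G < r"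
      by (intro graph_spectral_radius_less_if_neighbours_subset[OF G r(1) n T]) blast+
    then show False using r(2) by simp
  qed
  then obtain P where P: "star_packing G ?U P" "\<Union>P = ?U" by blast
  have "star_packing G (pverts G) (insert B P)"
    using P BV c cardB by (auto simp: star_packing_def disjoint_def)
  then show ?thesis using P(2) BV by blast
qed

theorem theorem1p3:
  fixes G :: "'a pair_pre_digraph" and k n :: nat
  assumes "k \<ge> 2"
    and "pair_graph G"
    and "card (pverts G) = n"
    and "real n \<ge> 3 / 2 * real k + 7"
    and "\<forall>v \<in> pverts G. \<exists>w. (v, w) \<in> parcs G"
    and "graph_spectral_radius G \<ge> graph_spectral_radius
           (graph_join (complete_graph 2)
             (disjoint_union (graph_copies 2 (complete_graph 1)) (complete_graph (n - 4))))"
    and "\<not> digraph_iso (with_proj G) (with_proj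
           (graph_join (complete_graph 2)
             (disjoint_union (graph_copies 2 (complete_graph 1)) (complete_graph (n - 4)))))"
  shows "\<forall>e \<in> parcs G. \<exists>F. S_factor k F G \<and>
           (\<exists>C \<in> graph_components F. e \<in> arcs C \<and>
             (complete_bipartite_digraph 1 1 C \<or> complete_bipartite_digraph 1 2 C))"
proof
  fix e assume "e \<in> parcs G"
  then obtain u v where e: "e = (u, v)" "(u, v) \<in> parcs G" by (cases e) auto
  interpret pair_graph G by fact
  let ?V = "pverts G"
  \<comment> \<open>The smallest value \<open>k = 2\<close> already gives
    \<open>3 / 2 * 2 + 7 = 10\<close>.\<close>
  have n: "n \<ge> 10" using assms(1,4) by linarith
  have sym: "(a, b) \<in> parcs G" if "(b, a) \<in> parcs G" for a b using that arcs_symmetric by blast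
  have uv: "u \<in> ?V" "v \<in> ?V" "u \<noteq> v" using e(2) no_loops' by (auto dest: wellformed')
  let ?H = "graph_join (complete_graph 2)
    (disjoint_union (graph_copies 2 (complete_graph 1)) (complete_graph (n - 4)))"
  obtain T' J' where H: "pair_graph ?H" "card (pverts ?H) = n" "parcs ?H = split_arcs (pverts ?H) T' J'"
    "T' \<subseteq> pverts ?H" "J' \<subseteq> pverts ?H" "T' \<inter> J' = {}" "card T' = 2" "card J' = 2"
    using extremal_graph_split[of n] n by auto
  \<comment> \<open>\<open>r\<close> stands in for the spectral radius of \<open>?H\<close>: it is
    at most that radius and exceeds \<open>n - 3\<close>.\<close>
  obtain r where r: "extremal_root n r" using ex_extremal_root[of n] n by auto
  have "r \<le> graph_spectral_radius ?H"
    using n by (intro extremal_root_le_graph_spectral_radius[OF r _ H]) simp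
  then have rG: "r \<le> graph_spectral_radius G" using assms(6) by simp
  \<comment> \<open>The isolated vertices of \<open>G - u - v\<close>.\<close>
  define I where "I = {x \<in> ?V - {u, v}. \<forall>w \<in> ?V - {u, v}. (x, w) \<notin> parcs G}"
  have I_nb: "w \<in> {u, v}" if "x \<in> I" "(x, w) \<in> parcs G" for x w
    using that by (auto simp: I_def dest: wellformed')
  have at_most_one: "x = y" if xy: "x \<in> I" "y \<in> I" for x y
  proof (rule ccontr)
    assume "x \<noteq> y"
    let ?T = "{u, v}" and ?J = "{x, y}"
    have TJ: "?T \<subseteq> ?V" "?J \<subseteq> ?V" "?T \<inter> ?J = {}" "card ?T = 2" "card ?J = 2"
      using uv xy \<open>x \<noteq> y\<close> by (auto simp: I_def)
    have "parcs G \<subseteq> split_arcs ?V ?T ?J"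
    proof (intro subrelI)
      fix a b assume ab: "(a, b) \<in> parcs G"
      then have "a \<in> ?V" "b \<in> ?V" "a \<noteq> b" using no_loops' by (auto dest: wellformed')
      then show "(a, b) \<in> split_arcs ?V ?T ?J"
        using ab sym[OF ab] I_nb xy by (auto simp: split_arcs_def)
    qed
    \<comment> \<open>Equality would make \<open>G\<close> isomorphic to the excluded graph.\<close>
    moreover have "parcs G \<noteq> split_arcs ?V ?T ?J"
      using digraph_iso_split_arcs[OF assms(2) H(1) _ _ TJ(1-3) H(3-6)] assms(3,7) H TJ by metis
    ultimately have "graph_spectral_radius G < r"
      using n by (intro graph_spectral_radius_less_extremal_root[OF r _ assms(2,3) _ TJ]) auto
    then show False using rG by simp
  qed
  \<comment> \<open>A center at \<open>u\<close> or \<open>v\<close> ensures that the arc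
    \<open>(u, v)\<close> joins the center to a leaf.\<close>
  have factor: "\<exists>F. S_factor k F G \<and> (\<exists>C \<in> graph_components F. e \<in> arcs C \<and>
      (complete_bipartite_digraph 1 1 C \<or> complete_bipartite_digraph 1 2 C))"
    if B: "B = {u, v} \<or> B = {u, v, x} \<and> x \<in> ?V \<and> x \<notin> {u, v} \<and>
        (\<forall>w. (x, w) \<in> parcs G \<longrightarrow> w \<in> {u, v})"
      and c: "star_center G B c" "c \<in> {u, v}"
      and deg: "\<And>y. y \<in> ?V - B \<Longrightarrow> \<exists>w \<in> ?V - B. (y, w) \<in> parcs G"
    for B c x
  proof -
    obtain P where P: "star_packing G ?V P" "\<Union>P = ?V" "B \<in> P"
      using small_star_extends_to_packing[OF assms(2) r rG assms(3) n uv B c(1) deg] by blast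
    show ?thesis
      unfolding e(1)
      by (rule S_factor_of_star_packing[OF assms(2) P(1,2) assms(1) P(3) c(1)])
        (use B c(2) uv in auto)
  qed
  show "\<exists>F. S_factor k F G \<and> (\<exists>C \<in> graph_components F. e \<in> arcs C \<and>
      (complete_bipartite_digraph 1 1 C \<or> complete_bipartite_digraph 1 2 C))"
  proof (cases "I = {}")
    case True
    have "star_center G {u, v} u" using e(2) by (auto simp: star_center_def)
    then show ?thesis
      by (rule factor[of "{u, v}", rotated]) (use True in \<open>auto simp: I_def\<close>)
  next
    case False
    then obtain x where x: "I = {x}" using at_most_one by blast
    then have xI: "x \<in> I" by simp
    then have xV: "x \<in> ?V" "x \<notin> {u, v}" by (auto simp: I_def)
    \<comment> \<open>As \<open>x\<close> is not isolated in \<open>G\<close>, it is adjacent to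
      \<open>u\<close> or \<open>v\<close>, and this end becomes the center of the star.\<close>
    obtain c where c: "(x, c) \<in> parcs G" using assms(5) xV by blast
    then have cuv: "c \<in> {u, v}" using I_nb xI by blast
    have cen: "star_center G {u, v, x} c"
      using cuv c e(2) sym by (auto simp: star_center_def)
    have "\<exists>w \<in> ?V - {u, v, x}. (y, w) \<in> parcs G" if y: "y \<in> ?V - {u, v, x}" for y
    proof -
      have "y \<notin> I" using x y by auto
      then obtain w where w: "w \<in> ?V - {u, v}" "(y, w) \<in> parcs G" using y by (auto simp: I_def)
      \<comment> \<open>All neighbours of \<open>x\<close> are \<open>u\<close> or \<open>v\<close>,
        so removing \<open>x\<close> as well isolates no further vertex.\<close>
      have "w \<noteq> x" using I_nb[OF xI] sym[OF w(2)] y by auto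
      then show ?thesis using w by blast
    qed
    then show ?thesis
      using xV I_nb[OF xI] by (intro factor[of "{u, v, x}" x, OF _ cen cuv]) blast+
  qed
qed

end
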